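(* Let $(E,\pi,B)$ be a locally trivial smooth fibre bundle. (i) Let $I$ be a smooth transport along paths in $(E,\pi,B)$, i.e. $I^{\gamma}_{a\to b}\in \mathrm{Diff}(\pi^{-1}(\gamma(a)),\pi^{-1}(\gamma(b)))$ for $\gamma:J\to B$, $J=[a,b]$, having the properties (R) and (P). Then the map $\varphi:\gamma\mapsto\varphi_\gamma$ defined by $$\varphi_\gamma:=I^{\gamma}_{a\to b}:\pi^{-1}(\gamma(a))\to\pi^{-1}(\gamma(b)),\qquad \gamma:[a,b]\to B,$$ is an axiomatically defined parallel transport. (ii) Vice versa, if $\varphi$ is an axiomatically defined parallel transport, then the maps $$I^{\gamma}_{s\to t}:=\varphi_{\gamma\circ\tau^J_t}\circ(\varphi_{\gamma\circ\tau^J_s})^{-1},\qquad s,t\in J=[a,b],\quad \gamma:J\to B,$$ in which $\tau^J_s:J\to[a,s]$, $s\in J$, are arbitrary orientation preserving diffeomorphisms, define a smooth transport along paths $I:\gamma\mapsto I^\gamma$, $I^\gamma:(s,t)\mapsto I^\gamma_{s\to t}$, satisfying (R) and (P).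
   Context: All real intervals are closed, i.e. of the form $[a,b]$ with $a\le b$. Paths $\gamma:J\to B$ are of class $C^1$. For $s=a$ the map $\tau^J_a:J\to[a,a]$ is the only (constant) map. $\mathrm{Diff}(M,N)$ is the set of diffeomorphisms from the manifold $M$ onto the manifold $N$. A transport along paths $I$ in $(E,\pi,B)$ is a map $I:\gamma\mapsto I^\gamma$ assigning to every path $\gamma:J\to B$ a map $I^\gamma:(s,t)\mapsto I^\gamma_{s\to t}$, $s,t\in J$, where the maps $I^\gamma_{s\to t}:\pi^{-1}(\gamma(s))\to\pi^{-1}(\gamma(t))$ satisfy $I^\gamma_{t\to r}\circ I^\gamma_{s\to t}=I^\gamma_{s\to r}$ for $r,s,t\in J$ and $I^\gamma_{s\to s}=\mathrm{id}_{\pi^{-1}(\gamma(s))}$ for $s\in J$. (R): $I^{\gamma|J'}_{s\to t}=I^\gamma_{s\to t}$, $s,t\in J'$, where $\gamma|J'$ is the restriction of $\gamma:J\to B$ to the subinterval $J'$ of $J$. (P): $I^{\gamma\circ\tau}_{s\to t}=I^\gamma_{\tau(s)\to\tau(t)}$, $s,t\in J''$, where $\gamma:J\to B$ and $\tau:J''\to J$ is a one-to-one map from the interval $J''$ onto $J$. For $\gamma:[0,1]\to B$ the (canonical) inverse path is $\gamma_-(s):=\gamma(1-s)$, $s\in[0,1]$. For $\gamma_1,\gamma_2:[0,1]\to B$ with $\gamma_1(1)=\gamma_2(0)$ the (canonical) product is $(\gamma_1\gamma_2)(s):=\gamma_1(2s)$ for $s\in[0,1/2]$ and $(\gamma_1\gamma_2)(s):=\gamma_2(2s-1)$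 for $s\in[1/2,1]$. An axiomatically defined parallel transport in $(E,\pi,B)$ is a map $\varphi:\gamma\mapsto\varphi_\gamma$ from the set of $C^1$ paths in $B$ to bundle morphisms of $(E,\pi,B)$ such that, for $\gamma:[a,b]\to B$, $\varphi_\gamma\in\mathrm{Diff}(\pi^{-1}(\gamma(a)),\pi^{-1}(\gamma(b)))$, and: (1) $\varphi_{\gamma\circ\tau}=\varphi_\gamma$ for $\gamma:[a,b]\to B$ and every orientation preserving diffeomorphism $\tau:[c,d]\to[a,b]$, $c\le d$; (2) $\varphi_{\gamma_-}=(\varphi_\gamma)^{-1}$ for $\gamma:[0,1]\to B$; (3) $\varphi_{\gamma_1\gamma_2}=\varphi_{\gamma_2}\circ\varphi_{\gamma_1}$ for $\gamma_1,\gamma_2:[0,1]\to B$ with $\gamma_1(1)=\gamma_2(0)$; (4) $\varphi_{\gamma_a}=\mathrm{id}_{\pi^{-1}(x_a)}$ for every one-point path $\gamma_a:\{a\}\to\{x_a\}$, $x_a\in B$, $a\in\mathbb{R}$.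
   Formalization: In (P) the one-to-one maps τ are taken to be C^1 diffeomorphisms of either orientation, since for arbitrary bijections (ii) is false (τ may swap two loops); axiom (3) is required only when the product path is again C^1, as φ is otherwise undefined there. *)

theory Defs
  imports "HOL-Analysis.Analysis"
begin

section \<open>Smooth manifolds\<close>

text \<open>
  Charts take values in a real inner product space \<open>'m\<close> that is required to be
  finite-dimensional.  The class \<open>euclidean_space\<close> is not used, because it forces positive
  dimension and so would exclude, for instance, bundles with discrete fibre.
\<close>

definition fin_dim :: "'m::real_inner itself \<Rightarrow> bool" where
  "fin_dim TYPE('m) \<longleftrightarrow> (\<exists>A::'m set. finite A \<and> span A = UNIV)"

text \<open>
  Only meant for an open set \<open>S\<close> of a finite-dimensional space, where having all directional
  derivatives of class \<open>C^k\<close> amounts to the total derivative being of class \<open>C^k\<close>.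
\<close>

primrec Ck_on :: "nat \<Rightarrow> 'a::real_normed_vector set \<Rightarrow> ('a \<Rightarrow> 'b::real_normed_vector) \<Rightarrow> bool" where
  "Ck_on 0 S f \<longleftrightarrow> continuous_on S f"
| "Ck_on (Suc k) S f \<longleftrightarrow>
     (\<exists>D. (\<forall>x\<in>S. (f has_derivative D x) (at x)) \<and> (\<forall>v. Ck_on k S (\<lambda>x. D x v)))"

definition smooth_on :: "'a::real_normed_vector set \<Rightarrow> ('a \<Rightarrow> 'b::real_normed_vector) \<Rightarrow> bool" where
  "smooth_on S f \<longleftrightarrow> (\<forall>k. Ck_on k S f)"

text \<open>
  A topological space with a (not necessarily maximal) atlas; a chart \<open>(U, \<kappa>)\<close> is a total
  function \<open>\<kappa>\<close> of which only the values on the open set \<open>U\<close> matter.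
\<close>

record ('a, 'm) manifold =
  mtop :: "'a topology"
  charts :: "('a set \<times> ('a \<Rightarrow> 'm)) set"

abbreviation points :: "('a, 'm) manifold \<Rightarrow> 'a set" where
  "points M \<equiv> topspace (mtop M)"

definition smooth_manifold :: "('a, 'm::real_inner) manifold \<Rightarrow> bool" where
  "smooth_manifold M \<longleftrightarrow>
     fin_dim TYPE('m) \<and> Hausdorff_space (mtop M) \<and> second_countable (mtop M) \<and>
     (\<forall>(U, \<kappa>)\<in>charts M. openin (mtop M) U \<and> open (\<kappa> ` U) \<and>
        homeomorphic_map (subtopology (mtop M) U) (top_of_set (\<kappa> ` U)) \<kappa>) \<and>
     (\<Union>(U, \<kappa>)\<in>charts M. U) = points M \<and>
     (\<forall>(U, \<kappa>)\<in>charts M. \<forall>(V, \<mu>)\<in>charts M. smooth_on (\<kappa> ` (U \<inter> V)) (\<mu> \<circ> inv_into U \<kappa>))"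

definition smooth_map ::
    "('a, 'm::real_inner) manifold \<Rightarrow> ('b, 'n::real_inner) manifold \<Rightarrow> ('a \<Rightarrow> 'b) \<Rightarrow> bool" where
  "smooth_map M N f \<longleftrightarrow>
     continuous_map (mtop M) (mtop N) f \<and>
     (\<forall>(U, \<kappa>)\<in>charts M. \<forall>(V, \<mu>)\<in>charts N.
        smooth_on (\<kappa> ` (U \<inter> f -` V)) (\<mu> \<circ> f \<circ> inv_into U \<kappa>))"

text \<open>
  Maps between sets are treated as in \<open>HOL-Library.FuncSet\<close>: they are extensional on their
  domain, so that equality of maps is equality in the logic.
\<close>

definition inverse_map :: "'a set \<Rightarrow> 'b set \<Rightarrow> ('a \<Rightarrow> 'b) \<Rightarrow> 'b \<Rightarrow> 'a" where
  "inverse_map A B f = restrict (inv_into A f) B"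

definition Diff ::
    "('a, 'm::real_inner) manifold \<Rightarrow> ('b, 'n::real_inner) manifold \<Rightarrow> ('a \<Rightarrow> 'b) set" where
  "Diff M N = {f \<in> points M \<rightarrow>\<^sub>E points N.
     bij_betw f (points M) (points N) \<and>
     smooth_map M N f \<and> smooth_map N M (inverse_map (points M) (points N) f)}"

definition open_submanifold :: "('a, 'm) manifold \<Rightarrow> 'a set \<Rightarrow> ('a, 'm) manifold" where
  "open_submanifold M W =
     \<lparr>mtop = subtopology (mtop M) W, charts = (\<lambda>(U, \<kappa>). (U \<inter> W, \<kappa>)) ` charts M\<rparr>"

definition prod_manifold ::
    "('a, 'm) manifold \<Rightarrow> ('b, 'n) manifold \<Rightarrow> ('a \<times> 'b, 'm \<times> 'n) manifold" where
  "prod_manifold M N =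
     \<lparr>mtop = prod_topology (mtop M) (mtop N),
      charts = {(U \<times> V, map_prod \<kappa> \<mu>) | U \<kappa> V \<mu>. (U, \<kappa>) \<in> charts M \<and> (V, \<mu>) \<in> charts N}\<rparr>"


section \<open>Locally trivial smooth fibre bundles\<close>

definition local_trivialization ::
    "('e, 'k::real_inner) manifold \<Rightarrow> ('b, 'm::real_inner) manifold \<Rightarrow> ('f, 'n::real_inner) manifold \<Rightarrow>
     ('e \<Rightarrow> 'b) \<Rightarrow> 'b set \<Rightarrow> ('e \<Rightarrow> 'b \<times> 'f) \<Rightarrow> bool" where
  "local_trivialization E B F \<pi> U \<Phi> \<longleftrightarrow>
     openin (mtop B) U \<and>
     \<Phi> \<in> Diff (open_submanifold E {u \<in> points E. \<pi> u \<in> U})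
              (prod_manifold (open_submanifold B U) F) \<and>
     (\<forall>u\<in>points E. \<pi> u \<in> U \<longrightarrow> fst (\<Phi> u) = \<pi> u)"

definition smooth_fibre_bundle ::
    "('e, 'k::real_inner) manifold \<Rightarrow> ('b, 'm::real_inner) manifold \<Rightarrow> ('f, 'n::real_inner) manifold \<Rightarrow>
     ('e \<Rightarrow> 'b) \<Rightarrow> bool" where
  "smooth_fibre_bundle E B F \<pi> \<longleftrightarrow>
     smooth_manifold E \<and> smooth_manifold B \<and> smooth_manifold F \<and>
     smooth_map E B \<pi> \<and> \<pi> ` points E = points B \<and>
     (\<forall>x\<in>points B. \<exists>U \<Phi>. x \<in> U \<and> local_trivialization E B F \<pi> U \<Phi>)"

definition fibre :: "('e, 'k) manifold \<Rightarrow> ('e \<Rightarrow> 'b) \<Rightarrow> 'b \<Rightarrow> 'e set" where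
  "fibre E \<pi> x = {u \<in> points E. \<pi> u = x}"

text \<open>
  The smooth structure of the fibre over \<open>x\<close> is the one for which \<open>snd \<circ> \<Phi>\<close> is a diffeomorphism
  of it onto the typical fibre, for every local trivialization \<open>\<Phi>\<close> around \<open>x\<close>; this is
  its structure as an embedded submanifold of the total space.
\<close>

definition fibre_manifold ::
    "('e, 'k::real_inner) manifold \<Rightarrow> ('b, 'm::real_inner) manifold \<Rightarrow> ('f, 'n::real_inner) manifold \<Rightarrow>
     ('e \<Rightarrow> 'b) \<Rightarrow> 'b \<Rightarrow> ('e, 'n) manifold" where
  "fibre_manifold E B F \<pi> x =
     \<lparr>mtop = subtopology (mtop E) (fibre E \<pi> x),
      charts = {({u \<in> fibre E \<pi> x. snd (\<Phi> u) \<in> V}, \<lambda>u. \<mu> (snd (\<Phi> u))) | U \<Phi> V \<mu>.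
        x \<in> U \<and> local_trivialization E B F \<pi> U \<Phi> \<and> (V, \<mu>) \<in> charts F}\<rparr>"


section \<open>Paths and reparametrizations\<close>

text \<open>
  \<open>S\<close> is meant to be relatively open in the interval \<open>J\<close>; derivatives at the ends of \<open>J\<close> are
  one-sided.  On a one-point interval the condition is void.
\<close>

definition C1_within :: "real set \<Rightarrow> real set \<Rightarrow> (real \<Rightarrow> 'm::real_normed_vector) \<Rightarrow> bool" where
  "C1_within J S f \<longleftrightarrow>
     (\<exists>D. (\<forall>t\<in>S. (f has_vector_derivative D t) (at t within J)) \<and> continuous_on S D)"

text \<open>A path \<open>\<gamma> : [a,b] \<rightarrow> B\<close> is given by its end points and an extensional function.\<close>

definition C1_path :: "('b, 'm::real_inner) manifold \<Rightarrow> real \<Rightarrow> real \<Rightarrow> (real \<Rightarrow> 'b) \<Rightarrow> bool" where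
  "C1_path B a b \<gamma> \<longleftrightarrow>
     a \<le> b \<and> \<gamma> \<in> {a..b} \<rightarrow>\<^sub>E points B \<and>
     continuous_map (top_of_set {a..b}) (mtop B) \<gamma> \<and>
     (\<forall>(U, \<kappa>)\<in>charts B. C1_within {a..b} ({a..b} \<inter> \<gamma> -` U) (\<kappa> \<circ> \<gamma>))"

text \<open>
  Diffeomorphisms \<open>[c,d] \<rightarrow> [a,b]\<close> are of class \<open>C^1\<close>, like the paths they reparametrize.
  For one-point intervals the only map is included, and it preserves orientation.
\<close>

definition interval_diffeo :: "real \<Rightarrow> real \<Rightarrow> real \<Rightarrow> real \<Rightarrow> (real \<Rightarrow> real) \<Rightarrow> bool" where
  "interval_diffeo c d a b \<tau> \<longleftrightarrow>
     c \<le> d \<and> a \<le> b \<and> \<tau> \<in> {c..d} \<rightarrow>\<^sub>E {a..b} \<and> bij_betw \<tau> {c..d} {a..b} \<and>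
     C1_within {c..d} {c..d} \<tau> \<and>
     C1_within {a..b} {a..b} (inverse_map {c..d} {a..b} \<tau>)"

definition orientation_preserving_diffeo ::
    "real \<Rightarrow> real \<Rightarrow> real \<Rightarrow> real \<Rightarrow> (real \<Rightarrow> real) \<Rightarrow> bool" where
  "orientation_preserving_diffeo c d a b \<tau> \<longleftrightarrow>
     interval_diffeo c d a b \<tau> \<and> strict_mono_on {c..d} \<tau>"

definition inverse_path :: "(real \<Rightarrow> 'b) \<Rightarrow> real \<Rightarrow> 'b" where
  "inverse_path \<gamma> = (\<lambda>s\<in>{0..1}. \<gamma> (1 - s))"

definition product_path :: "(real \<Rightarrow> 'b) \<Rightarrow> (real \<Rightarrow> 'b) \<Rightarrow> real \<Rightarrow> 'b" where
  "product_path \<gamma>1 \<gamma>2 = (\<lambda>s\<in>{0..1}. if s \<le> 1/2 then \<gamma>1 (2 * s) else \<gamma>2 (2 * s - 1))"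


section \<open>Transports along paths and parallel transports\<close>

text \<open>\<open>I a b \<gamma> s t\<close> is the transport from \<open>s\<close> to \<open>t\<close> along \<open>\<gamma> : [a,b] \<rightarrow> B\<close>.\<close>

type_synonym ('b, 'e) path_transport =
  "real \<Rightarrow> real \<Rightarrow> (real \<Rightarrow> 'b) \<Rightarrow> real \<Rightarrow> real \<Rightarrow> 'e \<Rightarrow> 'e"

definition transport_along_paths ::
    "('e, 'k) manifold \<Rightarrow> ('b, 'm::real_inner) manifold \<Rightarrow> ('e \<Rightarrow> 'b) \<Rightarrow>
     ('b, 'e) path_transport \<Rightarrow> bool" where
  "transport_along_paths E B \<pi> I \<longleftrightarrow>
     (\<forall>a b \<gamma>. C1_path B a b \<gamma> \<longrightarrow>
        (\<forall>s\<in>{a..b}. \<forall>t\<in>{a..b}. I a b \<gamma> s t \<in> fibre E \<pi> (\<gamma> s) \<rightarrow>\<^sub>E fibre E \<pi> (\<gamma> t)) \<and>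
        (\<forall>r\<in>{a..b}. \<forall>s\<in>{a..b}. \<forall>t\<in>{a..b}.
           compose (fibre E \<pi> (\<gamma> s)) (I a b \<gamma> t r) (I a b \<gamma> s t) = I a b \<gamma> s r) \<and>
        (\<forall>s\<in>{a..b}. I a b \<gamma> s s = (\<lambda>u\<in>fibre E \<pi> (\<gamma> s). u)))"

definition smooth_transport_along_paths ::
    "('e, 'k::real_inner) manifold \<Rightarrow> ('b, 'm::real_inner) manifold \<Rightarrow> ('f, 'n::real_inner) manifold \<Rightarrow>
     ('e \<Rightarrow> 'b) \<Rightarrow> ('b, 'e) path_transport \<Rightarrow> bool" where
  "smooth_transport_along_paths E B F \<pi> I \<longleftrightarrow>
     transport_along_paths E B \<pi> I \<and>
     (\<forall>a b \<gamma>. C1_path B a b \<gamma> \<longrightarrow>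
        I a b \<gamma> a b \<in> Diff (fibre_manifold E B F \<pi> (\<gamma> a)) (fibre_manifold E B F \<pi> (\<gamma> b)))"

definition property_R :: "('b, 'm::real_inner) manifold \<Rightarrow> ('b, 'e) path_transport \<Rightarrow> bool" where
  "property_R B I \<longleftrightarrow>
     (\<forall>a b \<gamma> a' b'. C1_path B a b \<gamma> \<and> a \<le> a' \<and> a' \<le> b' \<and> b' \<le> b \<longrightarrow>
        (\<forall>s\<in>{a'..b'}. \<forall>t\<in>{a'..b'}. I a' b' (restrict \<gamma> {a'..b'}) s t = I a b \<gamma> s t))"

text \<open>
  The bijections \<open>\<tau>\<close> are \<open>C^1\<close> diffeomorphisms of either orientation.  For an arbitrary bijection
  \<open>\<gamma> \<circ> \<tau>\<close> need not be a path; and it can be one in unwanted ways: if \<open>\<gamma>\<close> runs through two loops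
  with zero velocity at their ends, a discontinuous \<open>\<tau>\<close> can exchange the loops.
\<close>

definition property_P :: "('b, 'm::real_inner) manifold \<Rightarrow> ('b, 'e) path_transport \<Rightarrow> bool" where
  "property_P B I \<longleftrightarrow>
     (\<forall>a b \<gamma> c d \<tau>. C1_path B a b \<gamma> \<and> interval_diffeo c d a b \<tau> \<longrightarrow>
        (\<forall>s\<in>{c..d}. \<forall>t\<in>{c..d}. I c d (compose {c..d} \<gamma> \<tau>) s t = I a b \<gamma> (\<tau> s) (\<tau> t)))"

text \<open>
  The product of two \<open>C^1\<close> paths need not be of class \<open>C^1\<close>; the product axiom concerns the
  pairs for which it is.
\<close>

definition parallel_transport ::
    "('e, 'k::real_inner) manifold \<Rightarrow> ('b, 'm::real_inner) manifold \<Rightarrow> ('f, 'n::real_inner) manifold \<Rightarrow>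
     ('e \<Rightarrow> 'b) \<Rightarrow> (real \<Rightarrow> real \<Rightarrow> (real \<Rightarrow> 'b) \<Rightarrow> 'e \<Rightarrow> 'e) \<Rightarrow> bool" where
  "parallel_transport E B F \<pi> \<phi> \<longleftrightarrow>
     (\<forall>a b \<gamma>. C1_path B a b \<gamma> \<longrightarrow>
        \<phi> a b \<gamma> \<in> Diff (fibre_manifold E B F \<pi> (\<gamma> a)) (fibre_manifold E B F \<pi> (\<gamma> b))) \<and>
     (\<forall>a b \<gamma> c d \<tau>. C1_path B a b \<gamma> \<and> orientation_preserving_diffeo c d a b \<tau> \<longrightarrow>
        \<phi> c d (compose {c..d} \<gamma> \<tau>) = \<phi> a b \<gamma>) \<and>
     (\<forall>\<gamma>. C1_path B 0 1 \<gamma> \<longrightarrow>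
        \<phi> 0 1 (inverse_path \<gamma>) =
          inverse_map (fibre E \<pi> (\<gamma> 0)) (fibre E \<pi> (\<gamma> 1)) (\<phi> 0 1 \<gamma>)) \<and>
     (\<forall>\<gamma>1 \<gamma>2. C1_path B 0 1 \<gamma>1 \<and> C1_path B 0 1 \<gamma>2 \<and> \<gamma>1 1 = \<gamma>2 0 \<and>
        C1_path B 0 1 (product_path \<gamma>1 \<gamma>2) \<longrightarrow>
        \<phi> 0 1 (product_path \<gamma>1 \<gamma>2) = compose (fibre E \<pi> (\<gamma>1 0)) (\<phi> 0 1 \<gamma>2) (\<phi> 0 1 \<gamma>1)) \<and>
     (\<forall>a. \<forall>x\<in>points B. \<phi> a a (\<lambda>s\<in>{a}. x) = (\<lambda>u\<in>fibre E \<pi> x. u))"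

text \<open>
  \<open>T a b s\<close> is the chosen map \<open>[a,b] \<rightarrow> [a,s]\<close>, a diffeomorphism for \<open>a < s\<close> and
  the constant map for \<open>s = a\<close>.
\<close>

definition shrinking_diffeos :: "(real \<Rightarrow> real \<Rightarrow> real \<Rightarrow> real \<Rightarrow> real) \<Rightarrow> bool" where
  "shrinking_diffeos T \<longleftrightarrow>
     (\<forall>a b s. a \<le> b \<and> s \<in> {a..b} \<longrightarrow>
        (if s = a then T a b s = (\<lambda>r\<in>{a..b}. a)
         else orientation_preserving_diffeo a b a s (T a b s)))"

definition transport_of ::
    "('e, 'k) manifold \<Rightarrow> ('e \<Rightarrow> 'b) \<Rightarrow> (real \<Rightarrow> real \<Rightarrow> (real \<Rightarrow> 'b) \<Rightarrow> 'e \<Rightarrow> 'e) \<Rightarrow>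
     (real \<Rightarrow> real \<Rightarrow> real \<Rightarrow> real \<Rightarrow> real) \<Rightarrow> ('b, 'e) path_transport" where
  "transport_of E \<pi> \<phi> T a b \<gamma> s t =
     compose (fibre E \<pi> (\<gamma> s))
       (\<phi> a b (compose {a..b} \<gamma> (T a b t)))
       (inverse_map (fibre E \<pi> (\<gamma> a)) (fibre E \<pi> (\<gamma> s)) (\<phi> a b (compose {a..b} \<gamma> (T a b s))))"

end

theory Submission
  imports Defs
begin

text \<open>
  The restrictions of a path \<open>\<gamma>\<close> to subintervals \<open>[s,t]\<close> carry all the information: part (ii)
  amounts to \<open>I\<^sub>s\<^sub>t = \<phi>(\<gamma>|[s,t])\<close> for \<open>s \<le> t\<close> and \<open>I\<^sub>s\<^sub>t = \<phi>(\<gamma>|[t,s])\<inverse>\<close> for \<open>t \<le> s\<close>, and these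
  expressions do not mention the ambient interval, which is (R).  They rest on
  \<open>\<phi>(\<gamma>|[r,t]) = \<phi>(\<gamma>|[s,t]) \<circ> \<phi>(\<gamma>|[r,s])\<close>.  Concatenating affine reparametrizations of the two
  pieces does not give a \<open>C\<^sup>1\<close> reparametrization of \<open>\<gamma>|[r,t]\<close>; instead, \<open>\<gamma>|[r,t]\<close> is reparametrized by a
  Moebius transformation \<open>[0,1] \<rightarrow> [r,t]\<close> that sends \<open>1/2\<close> to \<open>s\<close>, and the resulting path is
  literally a canonical product.  A constant path is its own square, so that \<open>\<phi>\<close> maps
  it to an idempotent bijection, the identity.
\<close>

section \<open>Reparametrizations of intervals\<close>

text \<open>Derivatives at points of \<open>S\<close> are taken within \<open>J\<close>, so
  agreement is demanded on all of \<open>J\<close>. This is what allows passing between a function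
  and its extensional restriction.\<close>

lemma C1_within_cong:
  assumes "C1_within J S f" "S \<subseteq> J" "\<And>x. x \<in> J \<Longrightarrow> f x = g x"
  shows "C1_within J S g"
proof -
  obtain D where D: "\<forall>t\<in>S. (f has_vector_derivative D t) (at t within J)" "continuous_on S D"
    using assms(1) unfolding C1_within_def by blast
  then have "\<forall>t\<in>S. (g has_vector_derivative D t) (at t within J)"
    using assms(2,3) by (auto intro: has_vector_derivative_transform[where f = f])
  then show ?thesis using D(2) unfolding C1_within_def by blast
qed

lemma C1_within_imp_continuous_on:
  assumes "C1_within J J f"
  shows "continuous_on J f"
  using assms unfolding C1_within_def
  by (auto simp: continuous_on_eq_continuous_within intro: has_vector_derivative_continuous)

text \<open>Chain rule relative to \<open>S\<close>: for a path, \<open>S\<close> is the preimage of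
  a chart domain and has to be pulled back along with the function.\<close>

lemma C1_within_compose:
  assumes f: "C1_within J S f" and \<tau>: "C1_within K K \<tau>" "\<tau> \<in> K \<rightarrow> J"
  shows "C1_within K (K \<inter> \<tau> -` S) (f \<circ> \<tau>)"
proof -
  obtain D where D: "\<And>t. t \<in> S \<Longrightarrow> (f has_vector_derivative D t) (at t within J)"
    "continuous_on S D" using f unfolding C1_within_def by blast
  obtain D' where D': "\<And>t. t \<in> K \<Longrightarrow> (\<tau> has_vector_derivative D' t) (at t within K)"
    "continuous_on K D'" using \<tau> unfolding C1_within_def by blast
  have "continuous_on (K \<inter> \<tau> -` S) \<tau>"
    by (rule continuous_on_subset[OF C1_within_imp_continuous_on[OF \<tau>(1)]]) simp
  then have "continuous_on (K \<inter> \<tau> -` S) (\<lambda>t. D (\<tau> t))"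
    by (rule continuous_on_compose2[OF D(2)]) auto
  moreover have "continuous_on (K \<inter> \<tau> -` S) D'"
    by (rule continuous_on_subset[OF D'(2)]) simp
  ultimately have c: "continuous_on (K \<inter> \<tau> -` S) (\<lambda>t. D' t *\<^sub>R D (\<tau> t))"
    by (intro continuous_on_scaleR)
  have "(f \<circ> \<tau> has_vector_derivative D' t *\<^sub>R D (\<tau> t)) (at t within K)" if "t \<in> K \<inter> \<tau> -` S" for t
  proof (rule vector_diff_chain_within)
    show "(\<tau> has_vector_derivative D' t) (at t within K)" using D' that by auto
    show "(f has_vector_derivative D (\<tau> t)) (at (\<tau> t) within \<tau> ` K)"
      using that \<tau>(2) by (intro has_vector_derivative_within_subset[OF D(1)]) auto
  qed
  then show ?thesis using c unfolding C1_within_def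
    by (intro exI[of _ "\<lambda>t. D' t *\<^sub>R D (\<tau> t)"]) simp
qed

lemma C1_within_subset:
  assumes "C1_within J J f" "K \<subseteq> J"
  shows "C1_within K K f"
proof -
  obtain D where D: "\<forall>t\<in>J. (f has_vector_derivative D t) (at t within J)" "continuous_on J D"
    using assms(1) unfolding C1_within_def by blast
  have "(f has_vector_derivative D t) (at t within K)" if "t \<in> K" for t
    by (rule has_vector_derivative_within_subset[of f _ t J]) (use D(1) assms(2) that in auto)
  moreover have "continuous_on K D" by (rule continuous_on_subset[OF D(2) assms(2)])
  ultimately show ?thesis unfolding C1_within_def by (intro exI[of _ D]) simp
qed

lemma C1_within_affine: "C1_within J J (\<lambda>x::real. m * x + c)"
  unfolding C1_within_def
  by (intro exI[of _ "\<lambda>x. m"]) (auto intro!: derivative_eq_intros)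

section \<open>Diffeomorphisms between intervals and their orientation\<close>

text \<open>An explicit two-sided inverse \<open>g\<close> agrees with \<open>inverse_map\<close> on
  \<open>{a..b}\<close>, so later proofs can work with formulas instead of
  \<open>inv_into\<close>.\<close>

lemma interval_diffeoI:
  assumes "c \<le> d" "a \<le> b"
    and f: "\<And>x. x \<in> {c..d} \<Longrightarrow> f x \<in> {a..b}" "\<And>x. x \<in> {c..d} \<Longrightarrow> g (f x) = x"
    and g: "\<And>y. y \<in> {a..b} \<Longrightarrow> g y \<in> {c..d}" "\<And>y. y \<in> {a..b} \<Longrightarrow> f (g y) = y"
    and C1: "C1_within {c..d} {c..d} f" "C1_within {a..b} {a..b} g"
  shows "interval_diffeo c d a b (restrict f {c..d})"
proof -
  have bij: "bij_betw (restrict f {c..d}) {c..d} {a..b}"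
    by (rule bij_betwI[where g = g]) (use f g in auto)
  have "inverse_map {c..d} {a..b} (restrict f {c..d}) y = g y" if "y \<in> {a..b}" for y
    using bij_betw_inv_into_left[OF bij g(1)[OF that]] that g by (simp add: inverse_map_def)
  then have "C1_within {a..b} {a..b} (inverse_map {c..d} {a..b} (restrict f {c..d}))"
    by (intro C1_within_cong[OF C1(2)]) auto
  moreover have "C1_within {c..d} {c..d} (restrict f {c..d})"
    by (intro C1_within_cong[OF C1(1)]) auto
  ultimately show ?thesis
    using assms(1,2) bij f(1) unfolding interval_diffeo_def by auto
qed

lemma interval_diffeoD:
  fixes a b c d f
  defines "g \<equiv> inverse_map {c..d} {a..b} f"
  assumes "interval_diffeo c d a b f"
  shows "c \<le> d" "a \<le> b" "restrict f {c..d} = f"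
    and "\<And>x. x \<in> {c..d} \<Longrightarrow> f x \<in> {a..b}" "\<And>x. x \<in> {c..d} \<Longrightarrow> g (f x) = x"
    and "\<And>y. y \<in> {a..b} \<Longrightarrow> g y \<in> {c..d}" "\<And>y. y \<in> {a..b} \<Longrightarrow> f (g y) = y"
    and "C1_within {c..d} {c..d} f" "C1_within {a..b} {a..b} g"
proof -
  have bij: "bij_betw f {c..d} {a..b}" and f: "f \<in> {c..d} \<rightarrow>\<^sub>E {a..b}"
    using assms by (auto simp: interval_diffeo_def)
  show "c \<le> d" "a \<le> b" "C1_within {c..d} {c..d} f" "C1_within {a..b} {a..b} g"
    using assms by (auto simp: g_def interval_diffeo_def)
  show "restrict f {c..d} = f" using f by simp
  show fx: "f x \<in> {a..b}" if "x \<in> {c..d}" for x using f that by blast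
  show "g (f x) = x" if "x \<in> {c..d}" for x
    using that bij fx[OF that] by (simp add: g_def inverse_map_def bij_betw_inv_into_left)
  show "g y \<in> {c..d}" if "y \<in> {a..b}" for y
    using that bij bij_betw_inv_into[OF bij] by (auto simp: g_def inverse_map_def dest: bij_betwE)
  show "f (g y) = y" if "y \<in> {a..b}" for y
    using that bij by (simp add: g_def inverse_map_def bij_betw_inv_into_right)
qed

lemma interval_diffeo_compose:
  assumes \<sigma>: "interval_diffeo c d a b \<sigma>" and \<tau>: "interval_diffeo p q c d \<tau>"
  shows "interval_diffeo p q a b (compose {p..q} \<sigma> \<tau>)"
proof -
  define g where "g = inverse_map {c..d} {a..b} \<sigma>"
  note g = interval_diffeoD[OF \<sigma>, folded g_def]
  define h where "h = inverse_map {p..q} {c..d} \<tau>"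
  note h = interval_diffeoD[OF \<tau>, folded h_def]
  have "interval_diffeo p q a b (restrict (\<sigma> \<circ> \<tau>) {p..q})"
  proof (rule interval_diffeoI[where g = "h \<circ> g"])
    have "{p..q} \<inter> \<tau> -` {c..d} = {p..q}" using h(4) by blast
    then show "C1_within {p..q} {p..q} (\<sigma> \<circ> \<tau>)"
      using C1_within_compose[OF g(8) h(8)] h(4) by (metis Pi_I)
    have "{a..b} \<inter> g -` {c..d} = {a..b}" using g(6) by blast
    then show "C1_within {a..b} {a..b} (h \<circ> g)"
      using C1_within_compose[OF h(9) g(9)] g(6) by (metis Pi_I)
    show "(\<sigma> \<circ> \<tau>) x \<in> {a..b}" if "x \<in> {p..q}" for x
      using g(4)[OF h(4)[OF that]] by simp
    show "(h \<circ> g) ((\<sigma> \<circ> \<tau>) x) = x" if "x \<in> {p..q}" for x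
      using g(5)[OF h(4)[OF that]] h(5)[OF that] by simp
    show "(h \<circ> g) y \<in> {p..q}" if "y \<in> {a..b}" for y
      using h(6)[OF g(6)[OF that]] by simp
    show "(\<sigma> \<circ> \<tau>) ((h \<circ> g) y) = y" if "y \<in> {a..b}" for y
      using h(7)[OF g(6)[OF that]] g(7)[OF that] by simp
  qed (rule h(1) g(2))+
  then show ?thesis by (simp add: compose_def o_def)
qed

lemma orientation_preserving_compose:
  assumes \<sigma>: "orientation_preserving_diffeo c d a b \<sigma>"
    and \<tau>: "orientation_preserving_diffeo p q c d \<tau>"
  shows "orientation_preserving_diffeo p q a b (compose {p..q} \<sigma> \<tau>)"
proof -
  have "\<tau> \<in> {p..q} \<rightarrow> {c..d}"
    using \<tau> by (auto simp: orientation_preserving_diffeo_def interval_diffeo_def)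
  then show ?thesis
    using assms interval_diffeo_compose
    by (auto simp: orientation_preserving_diffeo_def strict_mono_on_def compose_def Pi_iff)
qed

text \<open>The preimage of \<open>a\<close> is at least \<open>c\<close>, so monotonicity gives
  \<open>\<tau> c \<le> a\<close>, while \<open>\<tau> c\<close> lies in \<open>{a..b}\<close>;
  dually for \<open>d\<close>.\<close>

lemma orientation_preserving_ends:
  assumes "orientation_preserving_diffeo c d a b \<tau>"
  shows "\<tau> c = a" "\<tau> d = b"
proof -
  have mono: "strict_mono_on {c..d} \<tau>" and diff: "interval_diffeo c d a b \<tau>"
    using assms by (auto simp: orientation_preserving_diffeo_def)
  define g where "g = inverse_map {c..d} {a..b} \<tau>"
  note g = interval_diffeoD[OF diff, folded g_def]
  note le = strict_mono_on_leD[OF mono]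
  have "a \<in> {a..b}" "b \<in> {a..b}" "c \<in> {c..d}" "d \<in> {c..d}" using g(1,2) by auto
  then show "\<tau> c = a" "\<tau> d = b"
    using le[of c "g a"] le[of "g b" d] g(4)[of c] g(4)[of d] g(6,7)[of a] g(6,7)[of b] by auto
qed

text \<open>The inverse of \<open>\<tau>\<close> also inverts the restriction. Strict monotonicity
  keeps its values on \<open>{\<tau> c'..\<tau> d'}\<close> inside \<open>{c'..d'}\<close>.\<close>

lemma orientation_preserving_restrict:
  assumes \<tau>: "orientation_preserving_diffeo c d a b \<tau>" and c': "c \<le> c'" "c' \<le> d'" "d' \<le> d"
  shows "orientation_preserving_diffeo c' d' (\<tau> c') (\<tau> d') (restrict \<tau> {c'..d'})"
proof -
  have mono: "strict_mono_on {c..d} \<tau>" and diff: "interval_diffeo c d a b \<tau>"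
    using assms by (auto simp: orientation_preserving_diffeo_def)
  define g where "g = inverse_map {c..d} {a..b} \<tau>"
  note g = interval_diffeoD[OF diff, folded g_def]
  note le = strict_mono_on_leD[OF mono]
  have sub: "{\<tau> c'..\<tau> d'} \<subseteq> {a..b}" using c' g(4)[of c'] g(4)[of d'] by auto
  have "interval_diffeo c' d' (\<tau> c') (\<tau> d') (restrict \<tau> {c'..d'})"
  proof (rule interval_diffeoI[where g = g])
    show "g y \<in> {c'..d'}" if y: "y \<in> {\<tau> c'..\<tau> d'}" for y
    proof -
      have y': "g y \<in> {c..d}" "\<tau> (g y) = y" using g(6,7) y sub by blast+
      have "\<not> g y < c'" "\<not> d' < g y"
        using strict_mono_onD[OF mono, of "g y" c'] strict_mono_onD[OF mono, of d' "g y"] y y' c'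
        by auto
      then show ?thesis by auto
    qed
    show "\<tau> x \<in> {\<tau> c'..\<tau> d'}" if "x \<in> {c'..d'}" for x
      using that c' le[of c' x] le[of x d'] by auto
    show "\<tau> c' \<le> \<tau> d'" using c' le[of c' d'] by auto
    show "C1_within {c'..d'} {c'..d'} \<tau>" using c' by (intro C1_within_subset[OF g(8)]) auto
    show "C1_within {\<tau> c'..\<tau> d'} {\<tau> c'..\<tau> d'} g" using g(9) sub by (rule C1_within_subset)
    show "g (\<tau> x) = x" if "x \<in> {c'..d'}" for x using that c' g(5)[of x] by auto
    show "\<tau> (g y) = y" if "y \<in> {\<tau> c'..\<tau> d'}" for y using that sub g(7) by blast
  qed (rule c')
  moreover have "strict_mono_on {c'..d'} (restrict \<tau> {c'..d'})"
    using mono c' by (auto simp: strict_mono_on_def)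
  ultimately show ?thesis by (simp add: orientation_preserving_diffeo_def)
qed

section \<open>Affine maps between intervals\<close>

text \<open>The slope may be negative, so that reflections are covered along with the stretching of
  one interval onto another.\<close>

lemma interval_diffeo_affine:
  assumes "m \<noteq> 0" "c \<le> d" "a \<le> b" and maps: "(\<lambda>x. m * x + k) ` {c..d} = {a..b}"
  shows "interval_diffeo c d a b (\<lambda>x\<in>{c..d}. m * x + k)"
proof (rule interval_diffeoI[where g = "\<lambda>y. (1 / m) * y + (- k / m)"])
  show "m * x + k \<in> {a..b}" if "x \<in> {c..d}" for x using that maps by blast
  have inv: "(1 / m) * (m * x + k) + (- k / m) = x" for x using assms(1) by (simp add: field_simps)
  show "(1 / m) * y + (- k / m) \<in> {c..d}" if "y \<in> {a..b}" for y
    using that maps inv by (metis (no_types, lifting) imageE)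
  show "(1 / m) * (m * x + k) + (- k / m) = x" for x by (rule inv)
  show "m * ((1 / m) * y + (- k / m)) + k = y" for y using assms(1) by (simp add: field_simps)
qed (rule assms C1_within_affine)+

lemma orientation_preserving_affine:
  fixes a b :: real
  assumes "a < b"
  shows "orientation_preserving_diffeo 0 1 a b (\<lambda>x\<in>{0..1}. (b - a) * x + a)"
proof -
  have "(\<lambda>x. (b - a) * x + a) ` {0..1} = {a..b}"
    using assms by (simp add: image_affinity_atLeastAtMost)
  then have "interval_diffeo 0 1 a b (\<lambda>x\<in>{0..1}. (b - a) * x + a)"
    using assms by (intro interval_diffeo_affine) auto
  then show ?thesis
    using assms by (simp add: orientation_preserving_diffeo_def strict_mono_on_def)
qed

lemma interval_diffeo_reflect:
  fixes c d :: real
  assumes "c \<le> d"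
  shows "interval_diffeo c d c d (\<lambda>x\<in>{c..d}. c + d - x)"
proof -
  have "(\<lambda>x. (-1) * x + (c + d)) ` {c..d} = {c..d}"
    using assms by (subst image_affinity_atLeastAtMost) auto
  then have "interval_diffeo c d c d (\<lambda>x\<in>{c..d}. (-1) * x + (c + d))"
    using assms by (intro interval_diffeo_affine) auto
  moreover have "(\<lambda>x\<in>{c..d}. (-1) * x + (c + d)) = (\<lambda>x\<in>{c..d}. c + d - x)"
    by (auto simp: restrict_def)
  ultimately show ?thesis by simp
qed

section \<open>Moebius reparametrizations of the unit interval\<close>

text \<open>In the coordinate \<open>x / (1 - x)\<close> this is multiplication by
  \<open>p / (1 - p)\<close>. Hence it fixes 0 and 1, sends 1/2 to \<open>p\<close>, and is inverted
  by exchanging \<open>p\<close> and \<open>1 - p\<close>.\<close>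

definition moebius :: "real \<Rightarrow> real \<Rightarrow> real" where
  "moebius p x = p * x / (p * x + (1 - p) * (1 - x))"

lemma moebius_denominator_pos:
  fixes p x :: real
  assumes "0 < p" "p < 1" "x \<in> {0..1}"
  shows "p * x + (1 - p) * (1 - x) > 0"
proof (cases "x = 0")
  case False
  then have "p * x > 0" using assms by simp
  moreover have "(1 - p) * (1 - x) \<ge> 0" using assms by (intro mult_nonneg_nonneg) auto
  ultimately show ?thesis by linarith
qed (use assms in auto)

lemma moebius_range:
  assumes "0 < p" "p < 1" "x \<in> {0..1}"
  shows "moebius p x \<in> {0..1}"
proof -
  have "p * x \<ge> 0" "(1 - p) * (1 - x) \<ge> 0"
    using assms by (auto intro!: mult_nonneg_nonneg)
  then show ?thesis
    using moebius_denominator_pos[OF assms] unfolding moebius_def by (simp add: divide_le_eq)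
qed

lemma moebius_inverse:
  assumes "0 < p" "p < 1" "x \<in> {0..1}"
  shows "moebius (1 - p) (moebius p x) = x"
proof -
  define N where "N = p * x + (1 - p) * (1 - x)"
  have N: "N > 0" using moebius_denominator_pos[OF assms] by (simp add: N_def)
  have m: "moebius p x = p * x / N" "1 - moebius p x = (1 - p) * (1 - x) / N"
    using N by (auto simp: moebius_def N_def field_simps)
  \<comment> \<open>This is the denominator of the outer map; the numerators combine because
    \<open>x + (1 - x) = 1\<close>.\<close>
  have "(1 - p) * moebius p x + p * (1 - moebius p x) = p * (1 - p) / N"
  proof -
    have "(1 - p) * (p * x / N) + p * ((1 - p) * (1 - x) / N)
      = ((1 - p) * (p * x) + p * ((1 - p) * (1 - x))) / N" by (simp add: add_divide_distrib)
    also have "(1 - p) * (p * x) + p * ((1 - p) * (1 - x)) = p * (1 - p)" by (simp add: algebra_simps)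
    finally show ?thesis unfolding m(2) unfolding m(1) .
  qed
  then have "moebius (1 - p) (moebius p x) = (1 - p) * (p * x / N) / (p * (1 - p) / N)"
    unfolding moebius_def[of "1 - p"] by (simp add: m(1))
  also have "\<dots> = x" using N assms by (simp add: field_simps)
  finally show ?thesis .
qed

lemma C1_within_moebius:
  assumes "0 < p" "p < 1"
  shows "C1_within {0..1} {0..1} (moebius p)"
  unfolding C1_within_def
proof (intro exI conjI ballI)
  let ?N = "\<lambda>x. p * x + (1 - p) * (1 - x)"
  let ?D = "\<lambda>x. (p * ?N x - p * x * (p - (1 - p))) / (?N x * ?N x)"
  have N: "?N x \<noteq> 0" if "x \<in> {0..1}" for x using moebius_denominator_pos[OF assms that] by simp
  show "(moebius p has_vector_derivative ?D x) (at x within {0..1})" if "x \<in> {0..1}" for x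
    unfolding moebius_def [abs_def] has_real_derivative_iff_has_vector_derivative[symmetric]
    by (rule derivative_eq_intros refl N[OF that])+ simp
  show "continuous_on {0..1} ?D"
    by (intro continuous_intros) (use N in auto)
qed

lemma orientation_preserving_moebius:
  assumes "0 < p" "p < 1"
  shows "orientation_preserving_diffeo 0 1 0 1 (restrict (moebius p) {0..1})"
  unfolding orientation_preserving_diffeo_def
proof
  have q: "0 < 1 - p" "1 - p < 1" using assms by auto
  show "interval_diffeo 0 1 0 1 (restrict (moebius p) {0..1})"
  proof (rule interval_diffeoI[where g = "moebius (1 - p)"])
    show "moebius p (moebius (1 - p) y) = y" if "y \<in> {0..1}" for y
      using moebius_inverse[OF q that] by simp
  qed (rule moebius_range moebius_inverse C1_within_moebius assms q zero_le_one | assumption)+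
  have "moebius p x < moebius p y" if "x \<in> {0..1}" "y \<in> {0..1}" "x < y" for x y
  proof -
    \<comment> \<open>The difference of the two values after cross-multiplication; its sign is that
      of \<open>y - x\<close>.\<close>
    have "p * y * (p * x + (1 - p) * (1 - x)) - p * x * (p * y + (1 - p) * (1 - y))
      = p * (1 - p) * (y - x)" by (simp add: algebra_simps)
    moreover have "p * (1 - p) * (y - x) > 0" using assms that by simp
    ultimately show ?thesis
      unfolding moebius_def
      using moebius_denominator_pos[OF assms that(1)] moebius_denominator_pos[OF assms that(2)]
      by (simp add: frac_less_eq divide_less_eq less_divide_eq field_simps)
  qed
  then show "strict_mono_on {0..1} (restrict (moebius p) {0..1})"
    by (auto simp: strict_mono_on_def)
qed

lemma orientation_preserving_through:
  fixes r s t :: real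
  assumes "r < s" "s < t"
  obtains \<sigma> where "orientation_preserving_diffeo 0 1 r t \<sigma>" "\<sigma> (1/2) = s"
proof
  \<comment> \<open>The relative position of \<open>s\<close> in \<open>[r,t]\<close>: the Moebius
    map sends 1/2 to \<open>p\<close>, and the affine map sends \<open>p\<close> to
    \<open>s\<close>.\<close>
  define p where "p = (s - r) / (t - r)"
  have p: "0 < p" "p < 1" using assms by (auto simp: p_def)
  let ?\<sigma> = "compose {0..1} (\<lambda>x\<in>{0..1}. (t - r) * x + r) (restrict (moebius p) {0..1})"
  show "orientation_preserving_diffeo 0 1 r t ?\<sigma>"
    using orientation_preserving_compose[OF orientation_preserving_affine
        orientation_preserving_moebius[OF p]] assms by auto
  have "moebius p (1/2) = p" by (simp add: moebius_def field_simps)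
  then show "?\<sigma> (1/2) = s"
    using p assms by (simp add: compose_def p_def)
qed

text \<open>A continuous injective function on an interval is strictly monotone. The decreasing case
  is expressed through the reflected map, so that the results on orientation preserving maps apply
  to it.\<close>

lemma interval_diffeo_cases:
  assumes "interval_diffeo c d a b \<tau>"
  obtains "orientation_preserving_diffeo c d a b \<tau>"
  | "orientation_preserving_diffeo c d a b (compose {c..d} \<tau> (\<lambda>x\<in>{c..d}. c + d - x))"
proof -
  have bij: "bij_betw \<tau> {c..d} {a..b}" and C1: "C1_within {c..d} {c..d} \<tau>" and cd: "c \<le> d"
    using assms by (auto simp: interval_diffeo_def)
  have "continuous_on {c..d} \<tau>"
    using C1 by (rule C1_within_imp_continuous_on)
  then consider "strict_mono_on {c..d} \<tau>" | "strict_antimono_on {c..d} \<tau>"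
    using bij injective_eq_monotone_map[of "{c..d}" \<tau>] is_interval_cc by (auto simp: bij_betw_def)
  then show ?thesis
  proof cases
    case 1
    then show ?thesis using that assms by (simp add: orientation_preserving_diffeo_def)
  next
    case 2
    then have "strict_mono_on {c..d} (compose {c..d} \<tau> (\<lambda>x\<in>{c..d}. c + d - x))"
      by (auto simp: strict_mono_on_def compose_def monotone_on_def)
    then show ?thesis
      using that interval_diffeo_compose[OF assms interval_diffeo_reflect[OF cd]]
      by (simp add: orientation_preserving_diffeo_def)
  qed
qed

section \<open>Paths\<close>

text \<open>Stated for an arbitrary \<open>C^1\<close> map into \<open>{a..b}\<close>, so that
  restriction to a subinterval, with the identity as \<open>\<tau>\<close>, and reparametrization of
  a segment are both instances.\<close>

lemma C1_path_compose:
  assumes \<gamma>: "C1_path B a b \<gamma>" and "c \<le> d" and \<tau>: "\<tau> \<in> {c..d} \<rightarrow> {a..b}" "C1_within {c..d} {c..d} \<tau>"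
  shows "C1_path B c d (compose {c..d} \<gamma> \<tau>)"
  unfolding C1_path_def
proof (intro conjI ballI)
  have \<gamma>': "\<gamma> \<in> {a..b} \<rightarrow>\<^sub>E points B" "continuous_map (top_of_set {a..b}) (mtop B) \<gamma>"
    using \<gamma> by (auto simp: C1_path_def)
  show "c \<le> d" by fact
  show "compose {c..d} \<gamma> \<tau> \<in> {c..d} \<rightarrow>\<^sub>E points B"
    using \<gamma>'(1) \<tau>(1) by (auto simp: compose_def Pi_iff PiE_iff)
  have "continuous_on {c..d} \<tau>"
    using \<tau>(2) by (rule C1_within_imp_continuous_on)
  then have "continuous_map (top_of_set {c..d}) (top_of_set {a..b}) \<tau>"
    using \<tau>(1) by auto
  then have "continuous_map (top_of_set {c..d}) (mtop B) (\<gamma> \<circ> \<tau>)"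
    using \<gamma>'(2) continuous_map_compose by blast
  then show "continuous_map (top_of_set {c..d}) (mtop B) (compose {c..d} \<gamma> \<tau>)"
    by (rule continuous_map_eq) (auto simp: compose_def)
  fix z assume z: "z \<in> charts B"
  obtain U \<kappa> where U: "z = (U, \<kappa>)" by force
  let ?S = "{a..b} \<inter> \<gamma> -` U"
  let ?T = "{c..d} \<inter> compose {c..d} \<gamma> \<tau> -` U"
  show "case z of (U, \<kappa>) \<Rightarrow>
      C1_within {c..d} ({c..d} \<inter> compose {c..d} \<gamma> \<tau> -` U) (\<kappa> \<circ> compose {c..d} \<gamma> \<tau>)"
  proof -
    have "C1_within {a..b} ?S (\<kappa> \<circ> \<gamma>)" using \<gamma> z U by (auto simp: C1_path_def)
    then have "C1_within {c..d} ({c..d} \<inter> \<tau> -` ?S) (\<kappa> \<circ> \<gamma> \<circ> \<tau>)"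
      by (rule C1_within_compose[OF _ \<tau>(2) \<tau>(1)])
    moreover have "{c..d} \<inter> \<tau> -` ?S = ?T" using \<tau>(1) by (auto simp: compose_def)
    ultimately have C1: "C1_within {c..d} ?T (\<kappa> \<circ> \<gamma> \<circ> \<tau>)" by simp
    have "C1_within {c..d} ?T (\<kappa> \<circ> compose {c..d} \<gamma> \<tau>)"
      using C1 by (rule C1_within_cong) (auto simp: compose_def)
    then show ?thesis by (simp add: U)
  qed
qed

lemma C1_path_reparametrize_segment:
  assumes "C1_path B a b \<gamma>" "interval_diffeo c d p q \<sigma>" "a \<le> p" "q \<le> b"
  shows "C1_path B c d (compose {c..d} \<gamma> \<sigma>)"
proof (rule C1_path_compose[OF assms(1)])
  have "\<sigma> x \<in> {p..q}" if "x \<in> {c..d}" for x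
    using assms(2) that by (auto simp: interval_diffeo_def PiE_iff)
  then show "\<sigma> \<in> {c..d} \<rightarrow> {a..b}" using assms(3,4) by fastforce
qed (use assms(2) in \<open>auto simp: interval_diffeo_def\<close>)

lemma C1_path_reparametrize:
  assumes "C1_path B a b \<gamma>" "interval_diffeo c d a b \<tau>"
  shows "C1_path B c d (compose {c..d} \<gamma> \<tau>)"
  using C1_path_reparametrize_segment[OF assms] by simp

lemma C1_path_restrict:
  assumes "C1_path B a b \<gamma>" "a \<le> a'" "a' \<le> b'" "b' \<le> b"
  shows "C1_path B a' b' (restrict \<gamma> {a'..b'})"
proof -
  have "C1_within {a'..b'} {a'..b'} (\<lambda>x::real. x)"
    using C1_within_affine[of _ 1 0] by simp
  then have "C1_path B a' b' (compose {a'..b'} \<gamma> (\<lambda>x. x))"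
    using assms by (intro C1_path_compose[OF assms(1)]) auto
  then show ?thesis by (simp add: compose_def)
qed

lemma C1_path_const:
  assumes "x \<in> points B" "a \<le> b"
  shows "C1_path B a b (\<lambda>s\<in>{a..b}. x)"
  unfolding C1_path_def
proof (intro conjI ballI)
  show "continuous_map (top_of_set {a..b}) (mtop B) (\<lambda>s\<in>{a..b}. x)"
    by (rule continuous_map_eq[of _ _ "\<lambda>s. x"]) (use assms in auto)
  fix z assume "z \<in> charts B"
  obtain U \<kappa> where z: "z = (U, \<kappa>)" by force
  have "C1_within {a..b} ({a..b} \<inter> (\<lambda>s\<in>{a..b}. x) -` U) (\<lambda>s. \<kappa> x)"
    unfolding C1_within_def by (intro exI[of _ "\<lambda>t. 0"]) auto
  then have "C1_within {a..b} ({a..b} \<inter> (\<lambda>s\<in>{a..b}. x) -` U) (\<kappa> \<circ> (\<lambda>s\<in>{a..b}. x))"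
    by (rule C1_within_cong) auto
  then show "case z of (U, \<kappa>) \<Rightarrow>
      C1_within {a..b} ({a..b} \<inter> (\<lambda>s\<in>{a..b}. x) -` U) (\<kappa> \<circ> (\<lambda>s\<in>{a..b}. x))"
    by (simp add: z)
qed (use assms in auto)

section \<open>Maps of fibres\<close>

lemma points_fibre_manifold [simp]: "points (fibre_manifold E B F \<pi> x) = fibre E \<pi> x"
  by (auto simp: fibre_manifold_def fibre_def)

lemma Diff_fibreD:
  assumes "f \<in> Diff (fibre_manifold E B F \<pi> x) (fibre_manifold E B F \<pi> y)"
  shows "f \<in> fibre E \<pi> x \<rightarrow>\<^sub>E fibre E \<pi> y" "bij_betw f (fibre E \<pi> x) (fibre E \<pi> y)"
  using assms by (auto simp: Diff_def)

lemma inverse_map_restrict_id: "inverse_map A A (\<lambda>u\<in>A. u) = (\<lambda>u\<in>A. u)"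
proof -
  have "inv_into A (\<lambda>u\<in>A. u) y = y" if "y \<in> A" for y
    by (rule inv_into_f_eq) (use that in \<open>auto simp: inj_on_def\<close>)
  then show ?thesis by (auto simp: inverse_map_def)
qed

text \<open>A right inverse of a bijection is its inverse; extensionality of \<open>g\<close> on
  \<open>C\<close> turns pointwise agreement into equality of functions.\<close>

lemma inverse_map_eqI:
  assumes "f \<in> A \<rightarrow>\<^sub>E C" "bij_betw f A C" "g \<in> extensional C"
    and "\<And>u. u \<in> C \<Longrightarrow> g u \<in> A" "\<And>u. u \<in> C \<Longrightarrow> f (g u) = u"
  shows "inverse_map A C f = g"
proof (rule extensionalityI[of _ C])
  fix u assume u: "u \<in> C"
  have "inv_into A f u = g u"
    by (rule inv_into_f_eq) (use assms u in \<open>auto simp: bij_betw_def\<close>)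
  then show "inverse_map A C f u = g u" using u by (simp add: inverse_map_def)
qed (use assms in \<open>auto simp: inverse_map_def\<close>)

lemma inverse_map_involutive:
  assumes f: "f \<in> A \<rightarrow>\<^sub>E C" "bij_betw f A C"
  shows "inverse_map C A (inverse_map A C f) = f"
proof (rule inverse_map_eqI)
  note inv = bij_betw_inv_into[OF f(2)]
  show "bij_betw (inverse_map A C f) C A"
    using inv by (rule bij_betw_cong[THEN iffD1, rotated]) (simp add: inverse_map_def)
  show "inverse_map A C f \<in> C \<rightarrow>\<^sub>E A"
    using bij_betwE[OF inv] by (auto simp: inverse_map_def)
  show "f u \<in> C" if "u \<in> A" for u using f(1) that by blast
  show "inverse_map A C f (f u) = u" if "u \<in> A" for u
    using f that bij_betw_inv_into_left[OF f(2) that] by (auto simp: inverse_map_def)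
qed (use f in \<open>auto simp: PiE_iff\<close>)

section \<open>Transports define parallel transports\<close>

text \<open>Invariance under reparametrization is (P) for increasing maps, and the inverse path is
  (P) for the reflection of \<open>[0,1]\<close>. For products, (R) cuts the path at 1/2 and (P)
  stretches both halves. One-point paths are the identity law of \<open>I\<close>.\<close>

lemma parallel_transport_of_transport:
  assumes smooth: "smooth_transport_along_paths E B F \<pi> I"
    and R: "property_R B I" and P: "property_P B I"
  shows "parallel_transport E B F \<pi> (\<lambda>a b \<gamma>. I a b \<gamma> a b)"
  unfolding parallel_transport_def
proof (intro conjI allI impI ballI)
  have Diff: "I a b \<gamma> a b \<in> Diff (fibre_manifold E B F \<pi> (\<gamma> a)) (fibre_manifold E B F \<pi> (\<gamma> b))"
    if "C1_path B a b \<gamma>" for a b \<gamma>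
    using smooth that by (auto simp: smooth_transport_along_paths_def)
  have trans: "transport_along_paths E B \<pi> I"
    using smooth by (auto simp: smooth_transport_along_paths_def)
  have maps: "I a b \<gamma> s t \<in> fibre E \<pi> (\<gamma> s) \<rightarrow>\<^sub>E fibre E \<pi> (\<gamma> t)"
    if "C1_path B a b \<gamma>" "s \<in> {a..b}" "t \<in> {a..b}" for a b \<gamma> s t
    using trans that by (simp add: transport_along_paths_def)
  have comp: "compose (fibre E \<pi> (\<gamma> s)) (I a b \<gamma> t r) (I a b \<gamma> s t) = I a b \<gamma> s r"
    if "C1_path B a b \<gamma>" "r \<in> {a..b}" "s \<in> {a..b}" "t \<in> {a..b}" for a b \<gamma> r s t
    using trans that by (simp add: transport_along_paths_def)
  have refl: "I a b \<gamma> s s = (\<lambda>u\<in>fibre E \<pi> (\<gamma> s). u)" if "C1_path B a b \<gamma>" "s \<in> {a..b}" for a b \<gamma> s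
    using trans that by (simp add: transport_along_paths_def)
  have reparam: "I c d (compose {c..d} \<gamma> \<tau>) s t = I a b \<gamma> (\<tau> s) (\<tau> t)"
    if "C1_path B a b \<gamma>" "interval_diffeo c d a b \<tau>" "s \<in> {c..d}" "t \<in> {c..d}" for a b \<gamma> c d \<tau> s t
    using P[unfolded property_P_def, rule_format, of a b \<gamma> c d \<tau> s t] that by simp
  show "I a b \<gamma> a b \<in> Diff (fibre_manifold E B F \<pi> (\<gamma> a)) (fibre_manifold E B F \<pi> (\<gamma> b))"
    if "C1_path B a b \<gamma>" for a b \<gamma> using Diff that .
  show "I c d (compose {c..d} \<gamma> \<tau>) c d = I a b \<gamma> a b"
    if "C1_path B a b \<gamma> \<and> orientation_preserving_diffeo c d a b \<tau>" for a b \<gamma> c d \<tau>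
  proof -
    have \<tau>: "interval_diffeo c d a b \<tau>" "c \<le> d"
      using that by (auto simp: orientation_preserving_diffeo_def interval_diffeo_def)
    then show ?thesis using that reparam[of a b \<gamma> c d \<tau> c d] orientation_preserving_ends[of c d a b \<tau>] by auto
  qed
  show "I 0 1 (inverse_path \<gamma>) 0 1
      = inverse_map (fibre E \<pi> (\<gamma> 0)) (fibre E \<pi> (\<gamma> 1)) (I 0 1 \<gamma> 0 1)"
    if \<gamma>: "C1_path B 0 1 \<gamma>" for \<gamma>
  proof -
    have "inverse_path \<gamma> = compose {0..1} \<gamma> (\<lambda>x\<in>{0..1}. 0 + 1 - x)"
      by (auto simp: inverse_path_def compose_def)
    then have inv: "I 0 1 (inverse_path \<gamma>) 0 1 = I 0 1 \<gamma> 1 0"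
      using reparam[OF \<gamma> interval_diffeo_reflect, of 0 1] by simp
    have "inverse_map (fibre E \<pi> (\<gamma> 0)) (fibre E \<pi> (\<gamma> 1)) (I 0 1 \<gamma> 0 1) = I 0 1 \<gamma> 1 0"
    proof (rule inverse_map_eqI[OF Diff_fibreD[OF Diff[OF \<gamma>]]])
      note m = maps[OF \<gamma>, of 1 0]
      show "I 0 1 \<gamma> 1 0 \<in> extensional (fibre E \<pi> (\<gamma> 1))" using m by (simp add: PiE_iff)
      fix u assume u: "u \<in> fibre E \<pi> (\<gamma> 1)"
      show "I 0 1 \<gamma> 1 0 u \<in> fibre E \<pi> (\<gamma> 0)" using m u by auto
      \<comment> \<open>The composition law for the round trip from 1 to 0 and back makes the
        backward transport a right inverse.\<close>
      have "compose (fibre E \<pi> (\<gamma> 1)) (I 0 1 \<gamma> 0 1) (I 0 1 \<gamma> 1 0) u = (\<lambda>u\<in>fibre E \<pi> (\<gamma> 1). u) u"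
        using comp[OF \<gamma>, of 1 1 0] refl[OF \<gamma>, of 1] by simp
      then show "I 0 1 \<gamma> 0 1 (I 0 1 \<gamma> 1 0 u) = u" using u by (simp add: compose_eq)
    qed
    then show ?thesis using inv by simp
  qed
  show "I 0 1 (product_path \<gamma>1 \<gamma>2) 0 1
      = compose (fibre E \<pi> (\<gamma>1 0)) (I 0 1 \<gamma>2 0 1) (I 0 1 \<gamma>1 0 1)"
    if "C1_path B 0 1 \<gamma>1 \<and> C1_path B 0 1 \<gamma>2 \<and> \<gamma>1 1 = \<gamma>2 0 \<and>
        C1_path B 0 1 (product_path \<gamma>1 \<gamma>2)" for \<gamma>1 \<gamma>2
  proof -
    let ?\<gamma> = "product_path \<gamma>1 \<gamma>2"
    have \<gamma>1: "C1_path B 0 1 \<gamma>1" and \<gamma>2: "C1_path B 0 1 \<gamma>2" and eq: "\<gamma>1 1 = \<gamma>2 0"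
      and \<gamma>: "C1_path B 0 1 ?\<gamma>" using that by auto
    have "(\<lambda>x::real. 2 * x + 0) ` {0..1/2} = {0..1}"
      by (subst image_affinity_atLeastAtMost) auto
    then have \<tau>1: "interval_diffeo 0 (1/2) 0 1 (\<lambda>x\<in>{0..1/2}. 2 * x + 0)"
      by (intro interval_diffeo_affine) auto
    have "(\<lambda>x::real. 2 * x + (-1)) ` {1/2..1} = {0..1}"
      by (subst image_affinity_atLeastAtMost) auto
    then have \<tau>2: "interval_diffeo (1/2) 1 0 1 (\<lambda>x\<in>{1/2..1}. 2 * x + (-1))"
      by (intro interval_diffeo_affine) auto
    have r1: "restrict ?\<gamma> {0..1/2} = compose {0..1/2} \<gamma>1 (\<lambda>x\<in>{0..1/2}. 2 * x + 0)"
      by (auto simp: product_path_def compose_def)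
    have r2: "restrict ?\<gamma> {1/2..1} = compose {1/2..1} \<gamma>2 (\<lambda>x\<in>{1/2..1}. 2 * x + (-1))"
      unfolding product_path_def compose_def restrict_restrict
    proof (rule ext)
      fix x :: real
      show "restrict (\<lambda>s. if s \<le> 1/2 then \<gamma>1 (2 * s) else \<gamma>2 (2 * s - 1)) ({0..1} \<inter> {1/2..1}) x
          = (\<lambda>x\<in>{1/2..1}. \<gamma>2 ((\<lambda>x\<in>{1/2..1}. 2 * x + - 1) x)) x"
      \<comment> \<open>At 1/2 the product takes its value from the first factor; the matching
        condition identifies it with the start of the second.\<close>
      proof (cases "x = 1/2")
        case True
        show ?thesis unfolding True using eq by simp
      qed auto
    qed
    have restr: "I 0 1 ?\<gamma> s t = I a' b' (restrict ?\<gamma> {a'..b'}) s t"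
      if "0 \<le> a'" "a' \<le> b'" "b' \<le> 1" "s \<in> {a'..b'}" "t \<in> {a'..b'}" for a' b' s t
      using R[unfolded property_R_def, rule_format, of 0 1 ?\<gamma> a' b' s t] \<gamma> that by simp
    have "I 0 1 ?\<gamma> 0 (1/2) = I 0 1 \<gamma>1 0 1"
      using restr[of 0 "1/2" 0 "1/2"] reparam[OF \<gamma>1 \<tau>1, of 0 "1/2"] unfolding r1 by simp
    moreover have "I 0 1 ?\<gamma> (1/2) 1 = I 0 1 \<gamma>2 0 1"
      using restr[of "1/2" 1 "1/2" 1] reparam[OF \<gamma>2 \<tau>2, of "1/2" 1] unfolding r2 by simp
    moreover have "?\<gamma> 0 = \<gamma>1 0" by (simp add: product_path_def)
    ultimately show ?thesis using comp[OF \<gamma>, of 1 0 "1/2"] by simp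
  qed
  show "I a a (\<lambda>s\<in>{a}. x) a a = (\<lambda>u\<in>fibre E \<pi> x. u)" if "x \<in> points B" for a x
    using refl[OF C1_path_const[OF that], of a a a] by simp
qed

section \<open>Parallel transports define transports\<close>

text \<open>Meant for \<open>s \<le> t\<close> only; transport backwards is written as an
  \<open>inverse_map\<close> of it.\<close>

definition segment_transport ::
    "(real \<Rightarrow> real \<Rightarrow> (real \<Rightarrow> 'b) \<Rightarrow> 'e \<Rightarrow> 'e) \<Rightarrow> (real \<Rightarrow> 'b) \<Rightarrow> real \<Rightarrow> real \<Rightarrow> 'e \<Rightarrow> 'e" where
  "segment_transport \<phi> \<gamma> s t = \<phi> s t (restrict \<gamma> {s..t})"

context
  fixes E :: "('e, 'k::real_inner) manifold"
    and B :: "('b, 'm::real_inner) manifold"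
    and F :: "('f, 'n::real_inner) manifold"
    and \<pi> :: "'e \<Rightarrow> 'b"
    and \<phi> :: "real \<Rightarrow> real \<Rightarrow> (real \<Rightarrow> 'b) \<Rightarrow> 'e \<Rightarrow> 'e"
  assumes parallel: "parallel_transport E B F \<pi> \<phi>"
begin

section \<open>The axioms of a parallel transport, and constant paths\<close>

lemma transport_Diff:
  assumes "C1_path B a b \<gamma>"
  shows "\<phi> a b \<gamma> \<in> Diff (fibre_manifold E B F \<pi> (\<gamma> a)) (fibre_manifold E B F \<pi> (\<gamma> b))"
  using parallel assms unfolding parallel_transport_def by blast

lemma transport_reparametrize:
  assumes "C1_path B a b \<gamma>" "orientation_preserving_diffeo c d a b \<tau>"
  shows "\<phi> c d (compose {c..d} \<gamma> \<tau>) = \<phi> a b \<gamma>"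
  using parallel assms unfolding parallel_transport_def by blast

lemma transport_inverse_path:
  assumes "C1_path B 0 1 \<gamma>"
  shows "\<phi> 0 1 (inverse_path \<gamma>) = inverse_map (fibre E \<pi> (\<gamma> 0)) (fibre E \<pi> (\<gamma> 1)) (\<phi> 0 1 \<gamma>)"
  using parallel assms unfolding parallel_transport_def by blast

lemma transport_product_path:
  assumes "C1_path B 0 1 \<gamma>1" "C1_path B 0 1 \<gamma>2" "\<gamma>1 1 = \<gamma>2 0"
    "C1_path B 0 1 (product_path \<gamma>1 \<gamma>2)"
  shows "\<phi> 0 1 (product_path \<gamma>1 \<gamma>2) = compose (fibre E \<pi> (\<gamma>1 0)) (\<phi> 0 1 \<gamma>2) (\<phi> 0 1 \<gamma>1)"
  using parallel assms unfolding parallel_transport_def by blast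

lemma transport_point:
  assumes "x \<in> points B"
  shows "\<phi> a a (\<lambda>s\<in>{a}. x) = (\<lambda>u\<in>fibre E \<pi> x. u)"
  using parallel assms unfolding parallel_transport_def by blast

text \<open>Needed because the map chosen for \<open>s = a\<close> collapses all of
  \<open>[a,b]\<close> to a point. The resulting path is constant on a possibly nondegenerate
  interval, whereas the axiom speaks of one-point intervals.\<close>

lemma transport_const:
  assumes x: "x \<in> points B" and "a \<le> b"
  shows "\<phi> a b (\<lambda>s\<in>{a..b}. x) = (\<lambda>u\<in>fibre E \<pi> x. u)"
proof (cases "a = b")
  case True
  then show ?thesis using transport_point[OF x] by simp
next
  case False
  then have ab: "a < b" using assms by simp
  let ?\<epsilon> = "\<lambda>s\<in>{0..1::real}. x"
  let ?f = "\<phi> 0 1 ?\<epsilon>"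
  note \<epsilon> = C1_path_const[OF x zero_le_one]
  have f: "?f \<in> fibre E \<pi> x \<rightarrow>\<^sub>E fibre E \<pi> x" "bij_betw ?f (fibre E \<pi> x) (fibre E \<pi> x)"
    using Diff_fibreD[OF transport_Diff[OF \<epsilon>]] by simp_all
  have "product_path ?\<epsilon> ?\<epsilon> = ?\<epsilon>"
    by (auto simp: product_path_def)
  then have "?f = compose (fibre E \<pi> x) ?f ?f"
    using transport_product_path[of ?\<epsilon> ?\<epsilon>] \<epsilon> by simp
  then have "?f u = ?f (?f u)" if "u \<in> fibre E \<pi> x" for u
    using that by (metis compose_eq)
  moreover have "?f u \<in> fibre E \<pi> x" if "u \<in> fibre E \<pi> x" for u
    using f that by blast
  \<comment> \<open>Injectivity cancels one application of \<open>?f\<close> from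
    \<open>?f u = ?f (?f u)\<close>.\<close>
  ultimately have "?f u = u" if "u \<in> fibre E \<pi> x" for u
    using that f(2) by (metis bij_betw_def inj_onD)
  then have id: "?f = (\<lambda>u\<in>fibre E \<pi> x. u)"
    by (intro extensionalityI[of _ "fibre E \<pi> x"]) (use f in \<open>auto simp: PiE_iff\<close>)
  \<comment> \<open>Products exist on \<open>[0,1]\<close> only; an affine map carries the result
    over to \<open>[a,b]\<close>.\<close>
  have \<tau>: "orientation_preserving_diffeo 0 1 a b (\<lambda>x\<in>{0..1}. (b - a) * x + a)"
    using ab by (rule orientation_preserving_affine)
  have "compose {0..1} (\<lambda>s\<in>{a..b}. x) (\<lambda>x\<in>{0..1}. (b - a) * x + a) = ?\<epsilon>"
    using \<tau> by (auto simp: compose_def orientation_preserving_diffeo_def interval_diffeo_def PiE_iff)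
  then show ?thesis
    using transport_reparametrize[OF C1_path_const[OF x] \<tau>] ab id by simp
qed

section \<open>Transport along the segments of a fixed path\<close>

context
  fixes a b :: real and \<gamma> :: "real \<Rightarrow> 'b"
  assumes \<gamma>: "C1_path B a b \<gamma>"
begin

text \<open>As \<open>\<sigma>\<close> takes values in \<open>{s..t}\<close>, it does not matter
  whether \<open>\<gamma>\<close> or its restriction is composed with it. The result depends on the
  segment alone, which makes the choice of the diffeomorphisms immaterial.\<close>

lemma transport_reparametrize_segment:
  assumes \<sigma>: "orientation_preserving_diffeo c d s t \<sigma>" and st: "a \<le> s" "t \<le> b"
  shows "\<phi> c d (compose {c..d} \<gamma> \<sigma>) = segment_transport \<phi> \<gamma> s t"
proof -
  have \<sigma>': "s \<le> t" "\<sigma> \<in> {c..d} \<rightarrow> {s..t}"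
    using \<sigma> by (auto simp: orientation_preserving_diffeo_def interval_diffeo_def)
  have "compose {c..d} \<gamma> \<sigma> = compose {c..d} (restrict \<gamma> {s..t}) \<sigma>"
    unfolding compose_def using \<sigma>'(2) by (intro restrict_ext) (auto simp: Pi_iff)
  then show ?thesis
    using transport_reparametrize[OF C1_path_restrict[OF \<gamma> st(1) \<sigma>'(1) st(2)] \<sigma>]
    by (simp add: segment_transport_def)
qed

lemma segment_transport_fibres:
  assumes "a \<le> s" "s \<le> t" "t \<le> b"
  shows "segment_transport \<phi> \<gamma> s t \<in> fibre E \<pi> (\<gamma> s) \<rightarrow>\<^sub>E fibre E \<pi> (\<gamma> t)"
    and "bij_betw (segment_transport \<phi> \<gamma> s t) (fibre E \<pi> (\<gamma> s)) (fibre E \<pi> (\<gamma> t))"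
  using Diff_fibreD[OF transport_Diff[OF C1_path_restrict[OF \<gamma> assms]]] assms
  by (simp_all add: segment_transport_def)

lemma path_point: "s \<in> {a..b} \<Longrightarrow> \<gamma> s \<in> points B"
  using \<gamma> by (auto simp: C1_path_def)

lemma segment_transport_refl:
  assumes "s \<in> {a..b}"
  shows "segment_transport \<phi> \<gamma> s s = (\<lambda>u\<in>fibre E \<pi> (\<gamma> s). u)"
proof -
  have "restrict \<gamma> {s..s} = (\<lambda>r\<in>{s}. \<gamma> s)" by auto
  then show ?thesis
    using transport_point[OF path_point[OF assms], of s] by (simp only: segment_transport_def)
qed

lemma segment_transport_additive:
  assumes "a \<le> r" "r \<le> s" "s \<le> t" "t \<le> b"
  shows "segment_transport \<phi> \<gamma> r t
    = compose (fibre E \<pi> (\<gamma> r)) (segment_transport \<phi> \<gamma> s t) (segment_transport \<phi> \<gamma> r s)"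
proof -
  consider "r = s" | "s = t" | "r < s" "s < t" using assms by linarith
  then show ?thesis
  proof cases
    case 1
    show ?thesis
      using segment_transport_refl[of s] segment_transport_fibres(1)[of s t] assms 1
      by (intro extensionalityI[of _ "fibre E \<pi> (\<gamma> r)"]) (auto simp: PiE_iff compose_eq)
  next
    case 2
    have "segment_transport \<phi> \<gamma> r s u \<in> fibre E \<pi> (\<gamma> s)" if "u \<in> fibre E \<pi> (\<gamma> r)" for u
      using segment_transport_fibres(1)[of r s] assms that by (auto simp: PiE_iff)
    then show ?thesis
      using segment_transport_refl[of s] segment_transport_fibres(1)[of r s] assms 2
      by (intro extensionalityI[of _ "fibre E \<pi> (\<gamma> r)"]) (auto simp: PiE_iff compose_eq)
  next
    case 3
    obtain \<sigma> where \<sigma>: "orientation_preserving_diffeo 0 1 r t \<sigma>" and mid: "\<sigma> (1/2) = s"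
      using orientation_preserving_through[OF 3] .
    note ends = orientation_preserving_ends[OF \<sigma>]
    \<comment> \<open>Affine maps of \<open>[0,1]\<close> onto its two halves, left unsimplified to
      be instances of \<open>orientation_preserving_affine\<close>. Then \<open>\<sigma>1\<close>
      and \<open>\<sigma>2\<close> are the halves of \<open>\<sigma>\<close> on the scale of
      \<open>[0,1]\<close>.\<close>
    let ?h1 = "\<lambda>x\<in>{0..1::real}. (1/2 - 0) * x + 0" and ?h2 = "\<lambda>x\<in>{0..1::real}. (1 - 1/2) * x + 1/2"
    define \<sigma>1 where "\<sigma>1 = compose {0..1} (restrict \<sigma> {0..1/2}) ?h1"
    define \<sigma>2 where "\<sigma>2 = compose {0..1} (restrict \<sigma> {1/2..1}) ?h2"
    have \<sigma>1: "orientation_preserving_diffeo 0 1 r s \<sigma>1"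
      using orientation_preserving_compose[OF orientation_preserving_restrict[OF \<sigma>, of 0 "1/2"]
          orientation_preserving_affine[of 0 "1/2"]] ends mid by (simp add: \<sigma>1_def)
    have \<sigma>2: "orientation_preserving_diffeo 0 1 s t \<sigma>2"
      using orientation_preserving_compose[OF orientation_preserving_restrict[OF \<sigma>, of "1/2" 1]
          orientation_preserving_affine[of "1/2" 1]] ends mid by (simp add: \<sigma>2_def)
    let ?\<gamma>1 = "compose {0..1} \<gamma> \<sigma>1" and ?\<gamma>2 = "compose {0..1} \<gamma> \<sigma>2"
    have C1: "C1_path B 0 1 (compose {0..1} \<gamma> \<rho>)"
      if "orientation_preserving_diffeo 0 1 p q \<rho>" "a \<le> p" "q \<le> b" for p q \<rho>
      using that C1_path_reparametrize_segment[OF \<gamma>] by (auto simp: orientation_preserving_diffeo_def)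
    \<comment> \<open>The rescaling in the product undoes \<open>?h1\<close> and \<open>?h2\<close>.
      The product is therefore a \<open>C^1\<close> path, as the product axiom requires.\<close>
    have prod: "product_path ?\<gamma>1 ?\<gamma>2 = compose {0..1} \<gamma> \<sigma>"
      unfolding product_path_def compose_def
    proof (rule restrict_ext)
      fix x :: real assume x: "x \<in> {0..1}"
      show "(if x \<le> 1/2 then (\<lambda>x\<in>{0..1}. \<gamma> (\<sigma>1 x)) (2 * x) else (\<lambda>x\<in>{0..1}. \<gamma> (\<sigma>2 x)) (2 * x - 1))
          = \<gamma> (\<sigma> x)"
        using x by (auto simp: \<sigma>1_def \<sigma>2_def compose_def field_simps)
    qed
    have "?\<gamma>1 0 = \<gamma> r" "?\<gamma>1 1 = ?\<gamma>2 0"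
      using orientation_preserving_ends[OF \<sigma>1] orientation_preserving_ends[OF \<sigma>2]
      by (simp_all add: compose_def)
    then have "\<phi> 0 1 (compose {0..1} \<gamma> \<sigma>) = compose (fibre E \<pi> (\<gamma> r)) (\<phi> 0 1 ?\<gamma>2) (\<phi> 0 1 ?\<gamma>1)"
      using transport_product_path[of ?\<gamma>1 ?\<gamma>2] C1[OF \<sigma>1] C1[OF \<sigma>2] C1[OF \<sigma>] assms
      by (simp add: prod)
    then show ?thesis
      using transport_reparametrize_segment[OF \<sigma>] transport_reparametrize_segment[OF \<sigma>1]
        transport_reparametrize_segment[OF \<sigma>2] assms by simp
  qed
qed

section \<open>The induced transport expressed by segments\<close>

context
  fixes T :: "real \<Rightarrow> real \<Rightarrow> real \<Rightarrow> real \<Rightarrow> real"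
  assumes T: "shrinking_diffeos T"
begin

text \<open>Removes \<open>T\<close> from the formula: for \<open>s = a\<close> the shrunk path is
  constant, otherwise it reparametrizes the segment from \<open>a\<close> to
  \<open>s\<close>.\<close>

lemma transport_shrunk_path:
  assumes "s \<in> {a..b}"
  shows "\<phi> a b (compose {a..b} \<gamma> (T a b s)) = segment_transport \<phi> \<gamma> a s"
proof (cases "s = a")
  case True
  then have "compose {a..b} \<gamma> (T a b s) = (\<lambda>r\<in>{a..b}. \<gamma> a)"
    using T assms by (auto simp: shrinking_diffeos_def compose_def)
  then show ?thesis
    using True transport_const[OF path_point, of a] segment_transport_refl[of a] assms by simp
next
  case False
  then have "orientation_preserving_diffeo a b a s (T a b s)"
    using T assms by (auto simp: shrinking_diffeos_def)
  then show ?thesis using assms by (intro transport_reparametrize_segment) auto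
qed

lemma transport_of_eq:
  assumes "s \<in> {a..b}" "t \<in> {a..b}"
  shows "transport_of E \<pi> \<phi> T a b \<gamma> s t
    = compose (fibre E \<pi> (\<gamma> s)) (segment_transport \<phi> \<gamma> a t)
        (inverse_map (fibre E \<pi> (\<gamma> a)) (fibre E \<pi> (\<gamma> s)) (segment_transport \<phi> \<gamma> a s))"
  using assms by (simp add: transport_of_def transport_shrunk_path)

text \<open>Here \<open>v\<close> is the point over the start of the path that is carried to
  \<open>u\<close>; the laws of the induced transport are computed by following it.\<close>

lemma inverse_initial_segment:
  assumes "s \<in> {a..b}" "u \<in> fibre E \<pi> (\<gamma> s)"
  defines "v \<equiv> inverse_map (fibre E \<pi> (\<gamma> a)) (fibre E \<pi> (\<gamma> s)) (segment_transport \<phi> \<gamma> a s) u"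
  shows "v \<in> fibre E \<pi> (\<gamma> a)" "segment_transport \<phi> \<gamma> a s v = u"
proof -
  have bij: "bij_betw (segment_transport \<phi> \<gamma> a s) (fibre E \<pi> (\<gamma> a)) (fibre E \<pi> (\<gamma> s))"
    using segment_transport_fibres(2)[of a s] assms by auto
  show "v \<in> fibre E \<pi> (\<gamma> a)"
    using bij_betwE[OF bij_betw_inv_into[OF bij]] assms(2) by (simp add: v_def inverse_map_def)
  show "segment_transport \<phi> \<gamma> a s v = u"
    using bij_betw_inv_into_right[OF bij assms(2)] assms(2) by (simp add: v_def inverse_map_def)
qed

lemma initial_segment_maps:
  assumes "s \<in> {a..b}" "v \<in> fibre E \<pi> (\<gamma> a)"
  shows "segment_transport \<phi> \<gamma> a s v \<in> fibre E \<pi> (\<gamma> s)"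
  using segment_transport_fibres(1)[of a s] assms by auto

lemma transport_of_maps:
  assumes "s \<in> {a..b}" "t \<in> {a..b}"
  shows "transport_of E \<pi> \<phi> T a b \<gamma> s t \<in> fibre E \<pi> (\<gamma> s) \<rightarrow>\<^sub>E fibre E \<pi> (\<gamma> t)"
  using assms inverse_initial_segment(1)[OF assms(1)] initial_segment_maps[OF assms(2)]
  by (auto simp: transport_of_eq compose_def)

text \<open>With \<open>Q s\<close> for the transport from \<open>a\<close> to \<open>s\<close>, the
  induced transport is \<open>Q t\<close> after the inverse of \<open>Q s\<close>. By additivity
  \<open>Q t\<close> is the transport of the segment after \<open>Q s\<close>, and
  \<open>Q s\<close> cancels.\<close>

lemma transport_of_forward:
  assumes "a \<le> s" "s \<le> t" "t \<le> b"
  shows "transport_of E \<pi> \<phi> T a b \<gamma> s t = segment_transport \<phi> \<gamma> s t"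
proof (rule extensionalityI[of _ "fibre E \<pi> (\<gamma> s)"])
  show "transport_of E \<pi> \<phi> T a b \<gamma> s t \<in> extensional (fibre E \<pi> (\<gamma> s))"
    using transport_of_maps[of s t] assms by (simp add: PiE_iff)
  show "segment_transport \<phi> \<gamma> s t \<in> extensional (fibre E \<pi> (\<gamma> s))"
    using segment_transport_fibres(1)[OF assms] by (simp add: PiE_iff)
  fix u assume u: "u \<in> fibre E \<pi> (\<gamma> s)"
  have s: "s \<in> {a..b}" "t \<in> {a..b}" using assms by auto
  have add: "segment_transport \<phi> \<gamma> a t
      = compose (fibre E \<pi> (\<gamma> a)) (segment_transport \<phi> \<gamma> s t) (segment_transport \<phi> \<gamma> a s)"
    using assms by (intro segment_transport_additive) auto
  show "transport_of E \<pi> \<phi> T a b \<gamma> s t u = segment_transport \<phi> \<gamma> s t u"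
    using inverse_initial_segment[OF s(1) u] u
    by (simp add: transport_of_eq[OF s] compose_eq add)
qed

text \<open>Additivity now splits the segment from \<open>a\<close> to \<open>s\<close> at
  \<open>t\<close>, which exhibits the induced transport as a right inverse of the transport from
  \<open>t\<close> to \<open>s\<close>.\<close>

lemma transport_of_backward:
  assumes "a \<le> t" "t \<le> s" "s \<le> b"
  shows "transport_of E \<pi> \<phi> T a b \<gamma> s t
    = inverse_map (fibre E \<pi> (\<gamma> t)) (fibre E \<pi> (\<gamma> s)) (segment_transport \<phi> \<gamma> t s)"
proof (rule inverse_map_eqI[symmetric, OF segment_transport_fibres[OF assms]])
  have s: "s \<in> {a..b}" "t \<in> {a..b}" using assms by auto
  note maps = transport_of_maps[OF s]
  show "transport_of E \<pi> \<phi> T a b \<gamma> s t \<in> extensional (fibre E \<pi> (\<gamma> s))"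
    using maps by (simp add: PiE_iff)
  fix u assume u: "u \<in> fibre E \<pi> (\<gamma> s)"
  show "transport_of E \<pi> \<phi> T a b \<gamma> s t u \<in> fibre E \<pi> (\<gamma> t)"
    using maps u by (simp add: PiE_iff)
  define v where "v = inverse_map (fibre E \<pi> (\<gamma> a)) (fibre E \<pi> (\<gamma> s)) (segment_transport \<phi> \<gamma> a s) u"
  note v = inverse_initial_segment[OF s(1) u, folded v_def]
  have "segment_transport \<phi> \<gamma> a s
      = compose (fibre E \<pi> (\<gamma> a)) (segment_transport \<phi> \<gamma> t s) (segment_transport \<phi> \<gamma> a t)"
    using assms by (intro segment_transport_additive) auto
  then have "segment_transport \<phi> \<gamma> t s (segment_transport \<phi> \<gamma> a t v) = u"
    using v by (simp add: compose_eq)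
  then show "segment_transport \<phi> \<gamma> t s (transport_of E \<pi> \<phi> T a b \<gamma> s t u) = u"
    using u by (simp add: transport_of_eq[OF s] compose_eq v_def)
qed

lemma transport_of_trans:
  assumes "r \<in> {a..b}" "s \<in> {a..b}" "t \<in> {a..b}"
  shows "compose (fibre E \<pi> (\<gamma> s)) (transport_of E \<pi> \<phi> T a b \<gamma> t r) (transport_of E \<pi> \<phi> T a b \<gamma> s t)
    = transport_of E \<pi> \<phi> T a b \<gamma> s r"
proof (rule extensionalityI[of _ "fibre E \<pi> (\<gamma> s)"])
  show "transport_of E \<pi> \<phi> T a b \<gamma> s r \<in> extensional (fibre E \<pi> (\<gamma> s))"
    using transport_of_maps[of s r] assms by (simp add: PiE_iff)
  fix u assume u: "u \<in> fibre E \<pi> (\<gamma> s)"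
  let ?Q = "segment_transport \<phi> \<gamma> a"
  let ?inv = "\<lambda>s. inverse_map (fibre E \<pi> (\<gamma> a)) (fibre E \<pi> (\<gamma> s)) (?Q s)"
  note v = inverse_initial_segment[OF assms(2) u]
  have w: "?Q t (?inv s u) \<in> fibre E \<pi> (\<gamma> t)" using initial_segment_maps[OF assms(3) v(1)] .
  note w' = inverse_initial_segment[OF assms(3) w]
  have "inj_on (?Q t) (fibre E \<pi> (\<gamma> a))"
    using segment_transport_fibres(2)[of a t] assms by (auto simp: bij_betw_def)
  \<comment> \<open>The two middle factors cancel: both sides have the same image under the
    injective \<open>?Q t\<close>.\<close>
  then have "?inv t (?Q t (?inv s u)) = ?inv s u"
    using w' v(1) by (auto dest: inj_onD)
  then show "compose (fibre E \<pi> (\<gamma> s)) (transport_of E \<pi> \<phi> T a b \<gamma> t r)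
      (transport_of E \<pi> \<phi> T a b \<gamma> s t) u = transport_of E \<pi> \<phi> T a b \<gamma> s r u"
    using assms u w by (simp add: transport_of_eq compose_eq)
qed (simp add: compose_def)

lemma transport_of_refl:
  assumes "s \<in> {a..b}"
  shows "transport_of E \<pi> \<phi> T a b \<gamma> s s = (\<lambda>u\<in>fibre E \<pi> (\<gamma> s). u)"
  using assms transport_of_forward[of s s] segment_transport_refl[of s] by simp

text \<open>Smoothness of a transport concerns only the map between the ends of the interval, and
  this reduces it to the corresponding property of \<open>\<phi>\<close>.\<close>

lemma transport_of_full:
  shows "transport_of E \<pi> \<phi> T a b \<gamma> a b = \<phi> a b \<gamma>"
proof -
  have "a \<le> b" "restrict \<gamma> {a..b} = \<gamma>"
    using \<gamma> by (auto simp: C1_path_def)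
  then show ?thesis using transport_of_forward[of a b] by (simp add: segment_transport_def)
qed

end

section \<open>Segments of reparametrized paths\<close>

lemma segment_transport_compose:
  assumes \<tau>: "orientation_preserving_diffeo c d a b \<tau>" and "c \<le> s" "s \<le> t" "t \<le> d"
  shows "segment_transport \<phi> (compose {c..d} \<gamma> \<tau>) s t = segment_transport \<phi> \<gamma> (\<tau> s) (\<tau> t)"
proof -
  have "\<tau> s \<in> {a..b}" "\<tau> t \<in> {a..b}"
    using assms by (auto simp: orientation_preserving_diffeo_def interval_diffeo_def PiE_iff)
  moreover have "restrict (compose {c..d} \<gamma> \<tau>) {s..t} = compose {s..t} \<gamma> (restrict \<tau> {s..t})"
    using assms by (auto simp: compose_def)
  ultimately show ?thesis
    using transport_reparametrize_segment[OF orientation_preserving_restrict[OF assms]]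
    by (simp add: segment_transport_def)
qed

text \<open>The segment of the reparametrized path runs through a segment of \<open>\<gamma>\<close>
  backwards. The inverse axiom covers only \<open>[0,1]\<close>, so both segments are rescaled to
  it, where one becomes the canonical inverse of the other.\<close>

lemma segment_transport_compose_reversing:
  assumes \<tau>: "interval_diffeo c d a b \<tau>"
    and op: "orientation_preserving_diffeo c d a b (compose {c..d} \<tau> (\<lambda>x\<in>{c..d}. c + d - x))"
    and st: "c \<le> s" "s \<le> t" "t \<le> d"
  shows "segment_transport \<phi> (compose {c..d} \<gamma> \<tau>) s t
    = inverse_map (fibre E \<pi> (\<gamma> (\<tau> t))) (fibre E \<pi> (\<gamma> (\<tau> s))) (segment_transport \<phi> \<gamma> (\<tau> t) (\<tau> s))"
    (is "_ = ?inv")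
    and "\<tau> t \<le> \<tau> s"
proof -
  let ?\<delta> = "compose {c..d} \<gamma> \<tau>"
  define \<rho> where "\<rho> = compose {c..d} \<tau> (\<lambda>x\<in>{c..d}. c + d - x)"
  have \<rho>: "orientation_preserving_diffeo c d a b \<rho>" using op by (simp add: \<rho>_def)
  have \<rho>_eq: "\<rho> x = \<tau> (c + d - x)" if "x \<in> {c..d}" for x using that by (simp add: \<rho>_def compose_def)
  have \<tau>_mem: "\<tau> s \<in> {a..b}" "\<tau> t \<in> {a..b}"
    using \<tau> st by (auto simp: interval_diffeo_def PiE_iff)
  have "strict_mono_on {c..d} \<rho>" using \<rho> by (simp add: orientation_preserving_diffeo_def)
  then have "\<rho> (c + d - t) \<le> \<rho> (c + d - s)"
    by (rule strict_mono_on_leD) (use st in auto)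
  then show le: "\<tau> t \<le> \<tau> s" using st by (simp add: \<rho>_eq)
  note \<delta> = C1_path_reparametrize[OF \<gamma> \<tau>]
  show "segment_transport \<phi> ?\<delta> s t = ?inv"
  proof (cases "s = t")
    \<comment> \<open>The rescaling needs \<open>s < t\<close>; for equal times both sides are the
      identity of the fibre.\<close>
    case True
    have "\<phi> t t (\<lambda>x\<in>{t}. \<gamma> (\<tau> t)) = (\<lambda>u\<in>fibre E \<pi> (\<gamma> (\<tau> t)). u)"
      by (rule transport_point[OF path_point[OF \<tau>_mem(2)]])
    moreover have "restrict ?\<delta> {t..t} = (\<lambda>x\<in>{t}. \<gamma> (\<tau> t))"
      using st True by (auto simp: compose_def)
    ultimately have "segment_transport \<phi> ?\<delta> s t = (\<lambda>u\<in>fibre E \<pi> (\<gamma> (\<tau> t)). u)"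
      unfolding True by (simp only: segment_transport_def)
    then show ?thesis
      using True segment_transport_refl[OF \<tau>_mem(2)] by (simp add: inverse_map_restrict_id)
  next
    case False
    then have "s < t" using st by simp
    let ?\<alpha> = "\<lambda>x\<in>{0..1}. (t - s) * x + s"
    let ?\<beta> = "\<lambda>x\<in>{0..1}. ((c + d - s) - (c + d - t)) * x + (c + d - t)"
    \<comment> \<open>\<open>?\<beta>\<close> maps \<open>[0,1]\<close> onto the mirror image of
      \<open>[s,t]\<close>, on which \<open>\<rho>\<close> increases from \<open>\<tau> t\<close> to
      \<open>\<tau> s\<close>.\<close>
    define \<sigma> where "\<sigma> = compose {0..1} (restrict \<rho> {c + d - t..c + d - s}) ?\<beta>"
    have "orientation_preserving_diffeo (c + d - t) (c + d - s) (\<tau> t) (\<tau> s)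
        (restrict \<rho> {c + d - t..c + d - s})"
      using orientation_preserving_restrict[OF \<rho>, of "c + d - t" "c + d - s"] st by (simp add: \<rho>_eq)
    then have \<sigma>: "orientation_preserving_diffeo 0 1 (\<tau> t) (\<tau> s) \<sigma>"
      unfolding \<sigma>_def using \<open>s < t\<close>
      by (intro orientation_preserving_compose[OF _ orientation_preserving_affine]) auto
    then have C1: "C1_path B 0 1 (compose {0..1} \<gamma> \<sigma>)"
      using \<tau>_mem C1_path_reparametrize_segment[OF \<gamma>] by (auto simp: orientation_preserving_diffeo_def)
    have "inverse_path (compose {0..1} \<gamma> \<sigma>) = compose {0..1} (restrict ?\<delta> {s..t}) ?\<alpha>"
      unfolding inverse_path_def compose_def
    proof (rule restrict_ext)
      fix x :: real assume x: "x \<in> {0..1}"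
      have y: "(t - s) * x \<in> {0..t - s}"
        using x \<open>s < t\<close> by (auto intro: mult_left_le)
      \<comment> \<open>Reversal of \<open>[0,1]\<close> corresponds to the reflection built into
        \<open>\<rho>\<close>, and the two cancel.\<close>
      have z: "?\<beta> (1 - x) = c + d - ((t - s) * x + s)"
        using x by (simp add: algebra_simps)
      have "\<sigma> (1 - x) = restrict \<rho> {c + d - t..c + d - s} (?\<beta> (1 - x))"
        using x by (simp add: \<sigma>_def compose_def)
      also have "\<dots> = \<rho> (c + d - ((t - s) * x + s))"
        unfolding z using y by simp
      also have "\<dots> = \<tau> ((t - s) * x + s)" using y st by (subst \<rho>_eq) auto
      finally show "(\<lambda>x\<in>{0..1}. \<gamma> (\<sigma> x)) (1 - x)
          = restrict (\<lambda>x\<in>{c..d}. \<gamma> (\<tau> x)) {s..t} (?\<alpha> x)"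
        using x y st by auto
    qed
    moreover have "\<phi> 0 1 (compose {0..1} (restrict ?\<delta> {s..t}) ?\<alpha>) = segment_transport \<phi> ?\<delta> s t"
      using transport_reparametrize[OF C1_path_restrict[OF \<delta> st]
          orientation_preserving_affine[OF \<open>s < t\<close>]] by (simp add: segment_transport_def)
    moreover have "\<phi> 0 1 (compose {0..1} \<gamma> \<sigma>) = segment_transport \<phi> \<gamma> (\<tau> t) (\<tau> s)"
      using transport_reparametrize_segment[OF \<sigma>] \<tau>_mem by simp
    moreover have "compose {0..1} \<gamma> \<sigma> 0 = \<gamma> (\<tau> t)" "compose {0..1} \<gamma> \<sigma> 1 = \<gamma> (\<tau> s)"
      using orientation_preserving_ends[OF \<sigma>] by (simp_all add: compose_def)
    ultimately show ?thesis
      using transport_inverse_path[OF C1] by simp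
  qed
qed

end

section \<open>Smoothness, restriction and reparametrization of the induced transport\<close>

lemma smooth_transport_of:
  assumes "shrinking_diffeos T"
  shows "smooth_transport_along_paths E B F \<pi> (transport_of E \<pi> \<phi> T)"
  unfolding smooth_transport_along_paths_def transport_along_paths_def
  using transport_of_maps[OF _ assms] transport_of_trans[OF _ assms] transport_of_refl[OF _ assms]
    transport_of_full[OF _ assms] transport_Diff
  by simp

lemma property_R_transport_of:
  assumes T: "shrinking_diffeos T"
  shows "property_R B (transport_of E \<pi> \<phi> T)"
  unfolding property_R_def
proof (intro allI impI ballI)
  fix a b \<gamma> a' b' s t
  assume *: "C1_path B a b \<gamma> \<and> a \<le> a' \<and> a' \<le> b' \<and> b' \<le> b"
    and s: "s \<in> {a'..b'}" and t: "t \<in> {a'..b'}"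
  let ?\<gamma>' = "restrict \<gamma> {a'..b'}"
  have \<gamma>: "C1_path B a b \<gamma>" and \<gamma>': "C1_path B a' b' ?\<gamma>'"
    using * by (auto intro: C1_path_restrict)
  have seg: "segment_transport \<phi> ?\<gamma>' p q = segment_transport \<phi> \<gamma> p q" if "a' \<le> p" "q \<le> b'" for p q
  proof -
    have "{a'..b'} \<inter> {p..q} = {p..q}" using that by auto
    then show ?thesis by (simp only: segment_transport_def restrict_restrict)
  qed
  show "transport_of E \<pi> \<phi> T a' b' ?\<gamma>' s t = transport_of E \<pi> \<phi> T a b \<gamma> s t"
  proof (cases "s \<le> t")
    case True
    then show ?thesis
      using transport_of_forward[OF \<gamma> T, of s t] transport_of_forward[OF \<gamma>' T, of s t] * s t
      by (simp add: seg)
  next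
    case False
    then show ?thesis
      using transport_of_backward[OF \<gamma> T, of t s] transport_of_backward[OF \<gamma>' T, of t s] * s t
      by (simp add: seg)
  qed
qed

text \<open>Four cases, by the orientation of \<open>\<tau>\<close> and the order of
  \<open>s\<close> and \<open>t\<close>. An orientation reversing \<open>\<tau>\<close> exchanges
  the forward and the backward description.\<close>

lemma property_P_transport_of:
  assumes T: "shrinking_diffeos T"
  shows "property_P B (transport_of E \<pi> \<phi> T)"
  unfolding property_P_def
proof (intro allI impI ballI)
  fix a b \<gamma> c d \<tau> s t
  assume *: "C1_path B a b \<gamma> \<and> interval_diffeo c d a b \<tau>"
    and s: "s \<in> {c..d}" and t: "t \<in> {c..d}"
  then have \<gamma>: "C1_path B a b \<gamma>" and \<tau>: "interval_diffeo c d a b \<tau>" by auto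
  let ?\<delta> = "compose {c..d} \<gamma> \<tau>"
  note \<delta> = C1_path_reparametrize[OF \<gamma> \<tau>]
  have \<tau>_mem: "\<tau> s \<in> {a..b}" "\<tau> t \<in> {a..b}"
    using \<tau> s t by (auto simp: interval_diffeo_def PiE_iff)
  have \<delta>_eq: "?\<delta> s = \<gamma> (\<tau> s)" "?\<delta> t = \<gamma> (\<tau> t)" using s t by (simp_all add: compose_def)
  note fw = transport_of_forward[OF \<gamma> T] transport_of_forward[OF \<delta> T]
  note bw = transport_of_backward[OF \<gamma> T] transport_of_backward[OF \<delta> T]
  show "transport_of E \<pi> \<phi> T c d ?\<delta> s t = transport_of E \<pi> \<phi> T a b \<gamma> (\<tau> s) (\<tau> t)"
    using \<tau>
  proof (cases rule: interval_diffeo_cases)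
    case 1
    then have mono: "strict_mono_on {c..d} \<tau>" by (simp add: orientation_preserving_diffeo_def)
    note seg = segment_transport_compose[OF \<gamma> 1]
    show ?thesis
    proof (cases "s \<le> t")
      case True
      then have "\<tau> s \<le> \<tau> t" using strict_mono_on_leD[OF mono s t] by simp
      then show ?thesis using True s t \<tau>_mem by (simp add: fw seg)
    next
      case False
      then have "\<tau> t \<le> \<tau> s" using strict_mono_on_leD[OF mono t s] by simp
      then show ?thesis using False s t \<tau>_mem by (simp add: bw seg \<delta>_eq)
    qed
  next
    case 2
    note seg = segment_transport_compose_reversing[OF \<gamma> \<tau> 2]
    show ?thesis
    proof (cases "s \<le> t")
      case True
      then show ?thesis using seg[of s t] s t \<tau>_mem by (simp add: fw bw)
    next
      case False
      then have le: "\<tau> s \<le> \<tau> t" using seg(2)[of t s] s t by simp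
      \<comment> \<open>The left side is backward transport along a segment whose transport is
        itself an inverse, hence the inverse of an inverse.\<close>
      then show ?thesis
        using False seg(1)[of t s] s t \<tau>_mem
          inverse_map_involutive[OF segment_transport_fibres[OF \<gamma> _ le]]
        by (simp add: fw bw \<delta>_eq)
    qed
  qed
qed

end

theorem theorem3p1:
  fixes E :: "('e, 'k::real_inner) manifold"
    and B :: "('b, 'm::real_inner) manifold"
    and F :: "('f, 'n::real_inner) manifold"
    and \<pi> :: "'e \<Rightarrow> 'b"
  assumes "smooth_fibre_bundle E B F \<pi>"
  shows "(\<forall>I. smooth_transport_along_paths E B F \<pi> I \<and> property_R B I \<and> property_P B I \<longrightarrow>
            parallel_transport E B F \<pi> (\<lambda>a b \<gamma>. I a b \<gamma> a b)) \<and>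
         (\<forall>\<phi> T. parallel_transport E B F \<pi> \<phi> \<and> shrinking_diffeos T \<longrightarrow>
            smooth_transport_along_paths E B F \<pi> (transport_of E \<pi> \<phi> T) \<and>
            property_R B (transport_of E \<pi> \<phi> T) \<and>
            property_P B (transport_of E \<pi> \<phi> T))"
proof (intro conjI allI impI; elim conjE)
  show "parallel_transport E B F \<pi> (\<lambda>a b \<gamma>. I a b \<gamma> a b)"
    if "smooth_transport_along_paths E B F \<pi> I" "property_R B I" "property_P B I" for I
    using that by (rule parallel_transport_of_transport)
qed (rule smooth_transport_of property_R_transport_of property_P_transport_of; assumption)+

end
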